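(* Write $Q(i,j,k,l)=i^2+j^2+k^2+6l^2+2ij+2ik+2jk+4il+4jl+4kl$ and $D_{i,j,k,l}=(q^2;q^2)_i(q^2;q^2)_j(q^2;q^2)_k(q^4;q^4)_l$. For all complex numbers $a,b$ the following identities hold: \begin{align*} &(1)\ \sum_{i,j,k,l\geq 0}\frac{(-1)^{i+j+l}q^{Q(i,j,k,l)+k}a^{i+k+2l}b^{j+k+2l}}{D_{i,j,k,l}}=(aq,bq;q^2)_\infty,\\ &(2)\ \sum_{i,j,k,l\geq 0}\frac{(-1)^lq^{Q(i,j,k,l)+j+k}}{D_{i,j,k,l}}=\frac{(q^3;q^3)^2_\infty}{(q;q)_\infty(q^6;q^6)_\infty},\\ &(3)\ \sum_{i,j,k,l\geq 0}\frac{(-1)^lq^{Q(i,j,k,l)-i-j+k}}{D_{i,j,k,l}}=\frac{3}{(q^2,q^2;q^4)_\infty},\\ &(4)\ \sum_{i,j,k,l\geq 0}\frac{(-1)^iq^{Q(i,j,k,l)+2i+2j+3k+6l}}{D_{i,j,k,l}}=\frac{(q^2,q^{14},q^{16};q^{16})_\infty}{(q^2;q^2)_\infty},\\ &(5)\ \sum_{i,j,k,l\geq 0}\frac{(-1)^iq^{Q(i,j,k,l)+k+2l}}{D_{i,j,k,l}}=\frac{(q^6,q^{10},q^{16};q^{16})_\infty}{(q^2;q^2)_\infty},\\ &(6)\ \sum_{i,j,k,l\geq 0}\frac{(-1)^iq^{Q(i,j,k,l)+j+2k+2l}}{D_{i,j,k,l}}=\frac{(q,q^7,q^8,q^{9},q^{15};q^{16})_\infty}{(q^2,q^3,q^4,q^4,q^5,q^{11},q^{12},q^{12},q^{13},q^{14};q^{16})_\infty},\\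 &(7)\ \sum_{i,j,k,l\geq 0}\frac{(-1)^iq^{Q(i,j,k,l)+2i+k+2l}}{D_{i,j,k,l}}=\frac{(q^3,q^5,q^8,q^{11},q^{13};q^{16})_\infty}{(q,q^4,q^4,q^6,q^{7},q^{9},q^{10},q^{12},q^{12},q^{15};q^{16})_\infty},\\ &(8)\ \sum_{i,j,k,l\geq 0}\frac{(-1)^iq^{Q(i,j,k,l)-j-2l}}{D_{i,j,k,l}}=\frac{2(q^6,q^{10},q^{16};q^{16})_\infty}{(q^2;q^2)_\infty},\\ &(9)\ \sum_{i,j,k,l\geq 0} \frac{(-1)^jq^{Q(i,j,k,l)+k}a^{i+j+2l}}{D_{i,j,k,l}}=(-q^2;q^2)_\infty (-a^2q^4;q^8)_\infty. \end{align*}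
   Context: Here $q$ is a complex number with $0<|q|<1$. For $|p|<1$, $(a;p)_\infty=\prod_{n\ge 0}(1-ap^n)$, and $(a;p)_n=(a;p)_\infty/(ap^n;p)_\infty=\prod_{k=0}^{n-1}(1-ap^k)$ for integers $n\ge 0$; $(a_1,\dots,a_m;p)_n=\prod_{k=1}^m(a_k;p)_n$ for $n\in\mathbb{N}\cup\{\infty\}$. Sums run over all quadruples of nonnegative integers $(i,j,k,l)$; $0^0=1$. *)

theory Defs
  imports "HOL-Analysis.Analysis"
begin

(* (a;p)_\<infinity>. The product converges absolutely for |p| < 1, so prodinf is the limit of the
   partial products; it is also correct (namely 0) when some factor vanishes. *)
definition qpoch_inf :: "complex \<Rightarrow> complex \<Rightarrow> complex" where
  "qpoch_inf a p = (\<Prod>n. 1 - a * p ^ n)"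

(* (a;p)_n, by the finite product, which agrees with (a;p)_\<infinity> / (a p^n;p)_\<infinity> whenever
   that denominator is nonzero *)
definition qpoch :: "complex \<Rightarrow> complex \<Rightarrow> nat \<Rightarrow> complex" where
  "qpoch a p n = (\<Prod>k<n. 1 - a * p ^ k)"

(* (a_1,...,a_m;p)_\<infinity> *)
definition qpochs_inf :: "complex list \<Rightarrow> complex \<Rightarrow> complex" where
  "qpochs_inf as p = (\<Prod>a\<leftarrow>as. qpoch_inf a p)"

definition quadQ :: "nat \<Rightarrow> nat \<Rightarrow> nat \<Rightarrow> nat \<Rightarrow> nat" where
  "quadQ i j k l = i^2 + j^2 + k^2 + 6*l^2 + 2*i*j + 2*i*k + 2*j*k + 4*i*l + 4*j*l + 4*k*l"

definition denomD :: "complex \<Rightarrow> nat \<Rightarrow> nat \<Rightarrow> nat \<Rightarrow> nat \<Rightarrow> complex" where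
  "denomD q i j k l =
     qpoch (q^2) (q^2) i * qpoch (q^2) (q^2) j * qpoch (q^2) (q^2) k * qpoch (q^4) (q^4) l"

end

theory Submission
  imports Defs
begin

text \<open>
  Since $Q(i,j,k,l) = n^2 + 2l^2$ with $n = i+j+k+2l$, the series
  $\sum x^i y^j z^k w^l q^Q / D$ equals $\sum_n q^{n^2} [t^n] F(t)$ with
  $F(t) = (-wq^2t^2;q^4)_\infty / (xt,yt,zt;q^2)_\infty$.
  In (1)--(3) we have $wq^2 = -z^2$, so $F(t) = (-zt;q^2)_\infty/(xt,yt;q^2)_\infty$ and the index $l$ disappears;
  $q$-Vandermonde then factors (1) and (3) into Euler series, and (2) becomes one step of the Bailey chain
  applied to Gauss' identity $\sum_r (-1)^r q^{r^2}/((q;q)_{n-r}(q;q)_{n+r}) = 1/(q^2;q^2)_n$.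
  In (4), (5), (8), (9) two of $x,y,z$ are opposite, and the $q$-binomial theorem leaves a single sum: an Euler
  series for (9), and Slater's sums $\sum s^{N^2}/(s^2;s^2)_N$ over even or odd $N$, with $s = iq$, for the others.
  Finally (7) and (6) are (5) plus or minus $q$ times (4), and a product of two theta functions gives
  their product form.
\<close>

text \<open>No power series in t occurs in the code. Each product formula in t enters as a finite
  identity for its coefficients, and the functional equation linking H(t) to H(pt) is the recurrence
  that proves it. Euler's series and the Durfee series are then limits of finite identities by
  dominated convergence, and together they give the triple product. All sums are unordered: a change
  of index needs only a bijection, but going back from an iterated sum to the full one needs
  summability of the whole family. This is proved for the quadruple sum by a Gaussian majorant and
  inherited by the later regroupings; only (2), where a new index is inserted, calls for a second
  estimate. The choice s = iq is dictated by s^2 = -q^2 and s^4 = q^4: (s^2;s^2)_(2n) then equals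
  (-q^2;q^4)_n (q^4;q^4)_n, the denominator left in the reduced sums. The modulus 16 arises from the
  even and odd terms of one theta series in s.\<close>

definition nome :: "complex \<Rightarrow> bool" where
  "nome p \<longleftrightarrow> p \<noteq> 0 \<and> norm p < 1"

lemma nome_power: "nome q \<Longrightarrow> n > 0 \<Longrightarrow> nome (q ^ n)"
  by (auto simp: nome_def norm_power power_less_one_iff)

lemma nome_nonzero: "nome p \<Longrightarrow> p \<noteq> 0"
  by (simp add: nome_def)

lemma nome_norm: "nome p \<Longrightarrow> norm p < 1"
  by (simp add: nome_def)

lemma nome_power_neq_1:
  assumes "nome p" "n > 0"
  shows "p ^ n \<noteq> 1"
  using nome_power[OF assms] by (auto simp: nome_def)

lemma nome_powi_neq_1:
  assumes "nome p" "n > 0"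
  shows "p powi n \<noteq> 1"
  using nome_power_neq_1[of p "nat n"] assms by (simp add: power_int_def)

lemma qpoch_0 [simp]: "qpoch a p 0 = 1"
  by (simp add: qpoch_def)

lemma qpoch_Suc: "qpoch a p (Suc n) = qpoch a p n * (1 - a * p ^ n)"
  by (simp add: qpoch_def)

lemma qpoch_self_nonzero:
  assumes "nome p"
  shows "qpoch p p n \<noteq> 0"
  using nome_power_neq_1[OF assms, of "Suc _"] by (auto simp: qpoch_def)

lemma qpoch_square: "qpoch (a^2) (p^2) n = qpoch a p n * qpoch (-a) p n"
  unfolding qpoch_def by (simp add: algebra_simps power2_eq_square power_mult_distrib flip: prod.distrib)

lemma qpoch_nonzero:
  assumes "norm a < 1" "norm p < 1"
  shows "qpoch a p n \<noteq> 0"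
proof -
  have "1 - a * p ^ k \<noteq> 0" for k
  proof -
    have "norm (a * p ^ k) \<le> norm a * 1"
      unfolding norm_mult norm_power by (intro mult_left_mono power_le_one) (use assms in auto)
    then show ?thesis
      using assms(1) by auto
  qed
  then show ?thesis
    by (simp add: qpoch_def)
qed

text \<open>The reciprocal of $(p;p)_n$, extended by $0$ to negative $n$: all summation indices can then range over
  the integers, and shifts and shears of the index lattice are bijections.\<close>

definition qrec :: "complex \<Rightarrow> int \<Rightarrow> complex" where
  "qrec p n = (if n < 0 then 0 else 1 / qpoch p p (nat n))"

lemma qrec_neg [simp]: "n < 0 \<Longrightarrow> qrec p n = 0"
  by (simp add: qrec_def)

lemma qrec_0 [simp]: "qrec p 0 = 1"
  by (simp add: qrec_def)

lemma qrec_of_nat: "qrec p (int n) = 1 / qpoch p p n"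
  by (simp add: qrec_def)

text \<open>The extension by zero is consistent with the recurrence: at n = 0 the factor 1 - p^0
  vanishes together with the left side, and for n < 0 both sides are 0. This relation drives all the
  finite identities.\<close>

lemma qrec_pred:
  assumes "nome p"
  shows "qrec p (n - 1) = (1 - p powi n) * qrec p n"
proof (cases "n > 0")
  case True
  define m where "m = nat (n - 1)"
  have n: "n = int (Suc m)"
    using True by (simp add: m_def)
  have "1 - p ^ Suc m \<noteq> 0"
    using nome_power_neq_1[OF assms, of "Suc m"] by simp
  moreover have "p powi n = p ^ Suc m"
    unfolding n by (rule power_int_of_nat)
  moreover have "qrec p (n - 1) = 1 / qpoch p p m"
    using n by (simp add: qrec_def)
  moreover have "qrec p n = 1 / (qpoch p p m * (1 - p ^ Suc m))"
    using n by (simp add: qrec_def nat_add_distrib qpoch_Suc)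
  ultimately show ?thesis
    by simp
next
  case False
  then show ?thesis
    by (cases "n = 0") auto
qed

section \<open>Finite identities\<close>

lemma int_course_induct:
  fixes n :: int
  assumes "\<And>n. n \<le> 0 \<Longrightarrow> P n"
    and "\<And>n. n > 0 \<Longrightarrow> (\<And>m. m < n \<Longrightarrow> P m) \<Longrightarrow> P n"
  shows "P n"
proof (induction "nat n" arbitrary: n rule: less_induct)
  case less
  show ?case
  proof (cases "n \<le> 0")
    case True
    then show ?thesis by (rule assms(1))
  next
    case False
    show ?thesis
      by (rule assms(2)) (use False less in \<open>auto simp: not_le le_less_linear intro!: less\<close>)
  qed
qed

lemma has_sum_shift_int:
  fixes f :: "int \<Rightarrow> 'a::{comm_monoid_add, topological_space}"
  shows "((\<lambda>n. f (n + c)) has_sum S) UNIV \<longleftrightarrow> (f has_sum S) UNIV"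
  by (rule has_sum_reindex_bij_witness[of _ "\<lambda>n. n - c" "\<lambda>n. n + c"]) auto

lemma has_sum_reflect_int:
  fixes f :: "int \<Rightarrow> 'a::{comm_monoid_add, topological_space}"
  shows "((\<lambda>n. f (c - n)) has_sum S) UNIV \<longleftrightarrow> (f has_sum S) UNIV"
  by (rule has_sum_reindex_bij_witness[of _ "\<lambda>n. c - n" "\<lambda>n. c - n"]) auto

text \<open>Telescoping: shifting one of two parts leaves the total unchanged when that part is
  summable by itself, which finite support guarantees. Recurrences that fail term by term are
  obtained this way.\<close>

lemma has_sum_shift_part:
  fixes A B :: "int \<Rightarrow> complex"
  assumes "((\<lambda>n. A n + B n) has_sum S) UNIV" and "finite {n. B n \<noteq> 0}"
  shows "((\<lambda>n. A n + B (n - 1)) has_sum S) UNIV"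
proof -
  have B: "(B has_sum infsum B UNIV) UNIV"
    using assms(2) by (intro has_sum_infsum finite_nonzero_values_imp_summable_on) simp
  then have B': "((\<lambda>n. B (n - 1)) has_sum infsum B UNIV) UNIV"
    using has_sum_shift_int[of B "-1"] by simp
  show ?thesis
    using has_sum_add[OF assms(1) has_sum_add[OF B' has_sum_uminusI[OF B]]] by (simp add: algebra_simps)
qed

lemma has_sum_only_0:
  fixes f :: "int \<Rightarrow> complex"
  assumes "\<And>n. n \<noteq> 0 \<Longrightarrow> f n = 0" and "f 0 = S"
  shows "(f has_sum S) UNIV"
  by (rule has_sum_finite_neutralI[of "{0}"]) (use assms in auto)

lemma powi_add: "q \<noteq> 0 \<Longrightarrow> (q::complex) powi m * q powi n = q powi (m + n)"
  by (simp add: power_int_add)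

lemma powi_cong: "m = n \<Longrightarrow> x powi m = x powi n"
  by simp

lemma neg_one_powi_pred: "(-1::complex) powi (n - 1) = - ((-1) powi n)"
  by (simp add: power_int_diff)

lemma neg_one_powi_shift: "(-1::complex) powi (n + 2 * m) = (-1) powi n"
proof -
  have "(-1::complex) powi (2 * m) = 1"
    by (simp only: power_int_mult) simp
  then show ?thesis
    using powi_add[of "-1" n "2 * m"] by simp
qed

lemma powi_quadratic:
  assumes "q \<noteq> (0::complex)"
  shows "(q powi m) powi k * (q ^ n) powi (k * k) = q powi (int n * k * k + m * k)"
  by (simp only: power_int_power power_int_mult[symmetric] powi_add[OF assms]) (simp add: algebra_simps)

lemma powi_quadratic_alternating:
  assumes "q \<noteq> (0::complex)"
  shows "(- (q powi m)) powi k * (q ^ n) powi (k * k) = (-1) powi k * q powi (int n * k * k + m * k)"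
  using powi_quadratic[OF assms, of m k n] power_int_mult_distrib[of "-1" "q powi m" k] by simp

lemma qrec_sq_pred: "nome q \<Longrightarrow> qrec (q^2) (n - 1) = (1 - q powi (2 * n)) * qrec (q^2) n"
  using qrec_pred[OF nome_power[of q 2]] by (simp add: power_int_power)

lemma qrec_4_pred: "nome q \<Longrightarrow> qrec (q^4) (n - 1) = (1 - q powi (4 * n)) * qrec (q^4) n"
  using qrec_pred[OF nome_power[of q 4]] by (simp add: power_int_power)

text \<open>The common frame of the finite identities. For nonpositive n only the term l = 0 can
  survive, so the base case is immediate. A recurrence yields the sum only up to a factor
  \<open>d n\<close>, in use \<open>1 - p powi n\<close> or \<open>1 - q powi (2 * n)\<close>,
  nonzero because the base has modulus below 1.\<close>

lemma has_sum_by_recurrence: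
  fixes f :: "int \<Rightarrow> int \<Rightarrow> complex"
  assumes "\<And>n l. n \<le> 0 \<Longrightarrow> l \<noteq> 0 \<Longrightarrow> f n l = 0"
    and "\<And>n. n \<le> 0 \<Longrightarrow> f n 0 = c n"
    and "\<And>n. n > 0 \<Longrightarrow> d n \<noteq> 0"
    and "\<And>n. n > 0 \<Longrightarrow> (\<And>m. m < n \<Longrightarrow> (f m has_sum c m) UNIV)
           \<Longrightarrow> ((\<lambda>l. d n * f n l) has_sum d n * c n) UNIV"
  shows "(f n has_sum c n) UNIV"
proof (induction n rule: int_course_induct)
  case (1 n)
  then show ?case
    using assms(1,2) by (intro has_sum_only_0) auto
next
  case (2 n)
  then show ?case
    using assms(3)[of n] assms(4)[of n] by (subst (asm) has_sum_cmult_right_iff) auto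
qed

lemma qrec_nonzero_imp: "qrec p n \<noteq> 0 \<Longrightarrow> n \<ge> 0"
  by (meson not_le qrec_neg)

text \<open>Coefficients of $(z^2t^2;q^4)_\infty / (zt;q^2)_\infty = (-zt;q^2)_\infty$.\<close>

lemma has_sum_qrec_cancel:
  assumes "nome q"
  shows "((\<lambda>l. (-1) powi l * q powi (2*l*l - 2*l) * qrec (q^2) (m - 2*l) * qrec (q^4) l)
           has_sum (q powi (m*m - m) * qrec (q^2) m)) UNIV"
proof (rule has_sum_by_recurrence[where d = "\<lambda>m. 1 - q powi (2 * m)" and n = m])
  fix m :: int
  assume m: "m > 0"
  define f where "f m l = (-1) powi l * q powi (2*l*l - 2*l) * qrec (q^2) (m - 2*l) * qrec (q^4) l" for m l
  define c where "c m = q powi (m*m - m) * qrec (q^2) m" for m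
  assume "(f k has_sum c k) UNIV" if "k < m" for k
  then have IH: "(f (m - 1) has_sum c (m - 1)) UNIV" "(f (m - 2) has_sum c (m - 2)) UNIV"
    by simp_all
  have IH': "((\<lambda>l. f (m - 2) (l - 1)) has_sum c (m - 2)) UNIV"
    using has_sum_shift_int[of "f (m-2)" "-1"] IH(2) by simp
  have q: "q \<noteq> 0" using assms by (rule nome_nonzero)
  \<comment> \<open>The recurrence is the coefficient of t^m in (1 - t) H(t) = (1 - t^2) H(q^2 t),
    where H(t) = (t^2;q^4)_inf / (t;q^2)_inf; hence the shift by two and the factor q^(2m-4). It
    holds term by term once l is lowered along with m.\<close>
  have f: "f (m-1) l + (- (q powi (2*m-4))) * f (m - 2) (l - 1) = (1 - q powi (2*m)) * f m l" for l
  proof -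
    have e: "qrec (q^2) (m - 1 - 2*l) = (1 - q powi (2*m) * q powi (-4*l)) * qrec (q^2) (m - 2*l)"
      using qrec_sq_pred[OF assms, of "m - 2*l"] by (simp add: powi_add q algebra_simps)
    have a: "q powi (2*m-4) * q powi (2*(l-1)*(l-1) - 2*(l-1)) = q powi (2*m) * q powi (-4*l) * q powi (2*l*l - 2*l)"
      by (simp add: powi_add q algebra_simps)
    have b: "q powi (-4*l) * q powi (4*l) = 1"
      by (simp add: powi_add q)
    have "q powi (2*m-4) * f (m - 2) (l - 1) = - ((-1) powi l * (q powi (2*m-4) * q powi (2*(l-1)*(l-1) - 2*(l-1)))
       * qrec (q^2) (m - 2*l) * (1 - q powi (4*l)) * qrec (q^4) l)"
      by (simp add: f_def neg_one_powi_pred qrec_4_pred[OF assms])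
    also have "\<dots> = - ((-1) powi l * q powi (2*m) * q powi (2*l*l - 2*l)
       * qrec (q^2) (m - 2*l) * (q powi (-4*l) - q powi (-4*l) * q powi (4*l)) * qrec (q^4) l)"
      unfolding a by algebra
    finally show ?thesis
      unfolding b f_def e by algebra
  qed
  have c: "c (m - 1) + (- (q powi (2*m-4))) * c (m - 2) = (1 - q powi (2*m)) * c m"
  proof -
    have "qrec (q^2) (m-2) = (1 - q powi (2 * m - 2)) * qrec (q^2) (m-1)"
      using qrec_sq_pred[OF assms, of "m-1"] by (simp add: algebra_simps)
    moreover have "q powi (2*m-4) * q powi ((m-2)*(m-2) - (m-2)) = q powi ((m-1)*(m-1) - (m-1))"
      by (simp add: powi_add q algebra_simps)
    moreover have "q powi ((m-1)*(m-1) - (m-1)) * q powi (2*m-2) = q powi (m*m-m)"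
      by (simp add: powi_add q algebra_simps)
    ultimately show ?thesis
      using qrec_sq_pred[OF assms, of m] unfolding c_def by algebra
  qed
  show "((\<lambda>l. (1 - q powi (2*m)) * f m l) has_sum (1 - q powi (2*m)) * c m) UNIV"
    using has_sum_add[OF IH(1) has_sum_cmult_right[OF IH', of "- (q powi (2*m-4))"]] unfolding f c .
next
  show "(-1) powi l * q powi (2*l*l - 2*l) * qrec (q^2) (m - 2*l) * qrec (q^4) l = 0"
    if "m \<le> 0" "l \<noteq> 0" for m l
    using that by (cases "l < 0") auto
  show "(-1) powi 0 * q powi (2*0*0 - 2*0) * qrec (q^2) (m - 2*0) * qrec (q^4) 0
    = q powi (m*m - m) * qrec (q^2) m" if "m \<le> 0" for m
    using that by (cases "m = 0") auto
qed (use nome_powi_neq_1[OF assms] in simp)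

text \<open>Induction on M with N fixed. It has three uses: it factors the triple sums of (1) and
  (3), it is the Bailey step in (2), and its limit is \<open>has_sum_Durfee\<close>.\<close>

lemma has_sum_q_Vandermonde:
  assumes "nome p"
  shows "((\<lambda>m. p powi ((M - m) * (N - m)) * qrec p (M - m) * qrec p (N - m) * qrec p m)
           has_sum (qrec p M * qrec p N)) UNIV"
proof (rule has_sum_by_recurrence[where d = "\<lambda>M. 1 - p powi M" and n = M])
  fix M :: int
  assume M: "M > 0"
  define f where "f M m = p powi ((M - m) * (N - m)) * qrec p (M - m) * qrec p (N - m) * qrec p m" for M m
  \<comment> \<open>\<open>A\<close> and \<open>B\<close> split the term for M - 1 by 1 = p^(N-m) +
    (1 - p^(N-m)). After \<open>B\<close> is moved by one index they recombine through 1 - p^M = (1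
    - p^(M-m)) + p^(M-m) (1 - p^m).\<close>
  define A where "A m = p powi ((M - m) * (N - m)) * qrec p (M - 1 - m) * qrec p (N - m) * qrec p m" for m
  define B where "B m = p powi ((M - 1 - m) * (N - m)) * qrec p (M - 1 - m) * qrec p (N - 1 - m) * qrec p m" for m
  assume "(f k has_sum qrec p k * qrec p N) UNIV" if "k < M" for k
  then have IH: "(f (M - 1) has_sum qrec p (M - 1) * qrec p N) UNIV"
    by simp
  have p: "p \<noteq> 0" using assms by (rule nome_nonzero)
  have "f (M - 1) m = A m + B m" for m
  proof -
    have "p powi ((M - m) * (N - m)) = p powi ((M - 1 - m) * (N - m)) * p powi (N - m)"
      by (simp add: powi_add p algebra_simps)
    moreover have "qrec p (N - 1 - m) = (1 - p powi (N - m)) * qrec p (N - m)"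
      using qrec_pred[OF assms, of "N - m"] by (simp add: algebra_simps)
    ultimately show ?thesis
      unfolding A_def B_def f_def by algebra
  qed
  moreover have "finite {m. B m \<noteq> 0}"
    by (rule finite_subset[of _ "{0..M}"]) (auto simp: B_def dest!: qrec_nonzero_imp)
  ultimately have "((\<lambda>m. A m + B (m - 1)) has_sum qrec p (M - 1) * qrec p N) UNIV"
    using IH has_sum_shift_part by (metis (no_types, lifting) ext)
  moreover have "A m + B (m - 1) = (1 - p powi M) * f M m" for m
  proof -
    have "B (m - 1) = p powi ((M - m) * (N - m)) * p powi (M - m) * qrec p (M - m) * qrec p (N - m) * ((1 - p powi m) * qrec p m)"
      unfolding B_def qrec_pred[OF assms, symmetric] by (simp add: powi_add p algebra_simps)
    moreover have "qrec p (M - 1 - m) = (1 - p powi (M - m)) * qrec p (M - m)"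
      using qrec_pred[OF assms, of "M - m"] by (simp add: algebra_simps)
    moreover have "p powi M = p powi (M - m) * p powi m"
      by (simp add: powi_add p)
    ultimately show ?thesis
      unfolding A_def f_def by algebra
  qed
  ultimately show "((\<lambda>m. (1 - p powi M) * f M m) has_sum (1 - p powi M) * (qrec p M * qrec p N)) UNIV"
    using qrec_pred[OF assms, of M] by (simp add: mult.assoc)
next
  show "p powi ((M - m) * (N - m)) * qrec p (M - m) * qrec p (N - m) * qrec p m = 0"
    if "M \<le> 0" "m \<noteq> 0" for M m
    using that by (cases "m < 0") auto
  show "p powi ((M - 0) * (N - 0)) * qrec p (M - 0) * qrec p (N - 0) * qrec p 0 = qrec p M * qrec p N"
    if "M \<le> 0" for M
    using that by (cases "M = 0") auto
qed (use nome_powi_neq_1[OF assms] in simp)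

text \<open>Coefficient of t^N in 1/((t;p)_inf (-t;p)_inf) = 1/(t^2;p^2)_inf. Writing H for this
  function, the step from N - 2 to N is (1 - t^2) H(t) = H(pt).\<close>

lemma has_sum_qrec_alternating:
  assumes "nome p"
  shows "((\<lambda>i. (-1) powi i * qrec p i * qrec p (N - i))
           has_sum (if even N then qrec (p^2) (N div 2) else 0)) UNIV"
proof (rule has_sum_by_recurrence[where d = "\<lambda>N. 1 - p powi N" and n = N])
  fix N :: int
  assume N: "N > 0"
  define f where "f N i = (-1) powi i * qrec p i * qrec p (N - i)" for N i
  define c where "c N = (if even N then qrec (p^2) (N div 2) else 0)" for N :: int
  \<comment> \<open>Split by 1 - p^i; after the shift of \<open>C\<close> the parts recombine by 1 -
    p^N = p^i (1 - p^(N-i)) + (1 - p^i).\<close>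
  define A where "A i = (-1) powi i * p powi i * qrec p i * qrec p (N - 1 - i)" for i
  define C where "C i = - ((-1) powi i * qrec p i * qrec p (N - 1 - i))" for i
  assume "(f k has_sum c k) UNIV" if "k < N" for k
  then have "(f (N - 2) has_sum c (N - 2)) UNIV"
    by simp
  then have IH: "((\<lambda>i. f (N - 2) (i - 1)) has_sum c (N - 2)) UNIV"
    using has_sum_shift_int[of "f (N-2)" "-1"] by simp
  have "f (N - 2) (i - 1) = A i + C i" for i
    by (simp add: A_def C_def f_def neg_one_powi_pred qrec_pred[OF assms] algebra_simps)
  moreover have "finite {i. C i \<noteq> 0}"
    by (rule finite_subset[of _ "{0..N}"]) (auto simp: C_def dest!: qrec_nonzero_imp)
  ultimately have "((\<lambda>i. A i + C (i - 1)) has_sum c (N - 2)) UNIV"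
    using IH has_sum_shift_part by (metis (no_types, lifting) ext)
  moreover have "A i + C (i - 1) = (1 - p powi N) * f N i" for i
  proof -
    have "C (i - 1) = (-1) powi i * ((1 - p powi i) * qrec p i) * qrec p (N - i)"
      unfolding C_def qrec_pred[OF assms, symmetric] by (simp add: neg_one_powi_pred)
    moreover have "qrec p (N - 1 - i) = (1 - p powi (N - i)) * qrec p (N - i)"
      using qrec_pred[OF assms, of "N - i"] by (simp add: algebra_simps)
    moreover have "p powi N = p powi (N - i) * p powi i"
      by (simp add: powi_add nome_nonzero[OF assms])
    ultimately show ?thesis
      unfolding A_def f_def by algebra
  qed
  moreover have "c (N - 2) = (1 - p powi N) * c N"
  proof (cases "even N")
    case True
    then have "p powi N = (p^2) powi (N div 2)"
      by (simp add: power_int_power)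
    moreover have "(N - 2) div 2 = N div 2 - 1"
      by simp
    ultimately show ?thesis
      using True qrec_pred[OF nome_power[OF assms, of 2], of "N div 2"] by (simp add: c_def)
  qed (simp add: c_def)
  ultimately show "((\<lambda>i. (1 - p powi N) * f N i) has_sum (1 - p powi N) * c N) UNIV"
    by simp
next
  show "(-1) powi i * qrec p i * qrec p (N - i) = 0" if "N \<le> 0" "i \<noteq> 0" for N i
    using that by (cases "i < 0") auto
  show "(-1) powi 0 * qrec p 0 * qrec p (N - 0) = (if even N then qrec (p^2) (N div 2) else 0)"
    if "N \<le> 0" for N
    using that by (cases "N = 0") auto
qed (use nome_powi_neq_1[OF assms] in simp)

text \<open>The finite q-binomial theorem, divided by (q^2;q^2)_r. For negative r the value of
  \<open>nat r\<close> is irrelevant, since \<open>qrec\<close> annihilates both sides.\<close>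

lemma has_sum_q_binomial:
  assumes "nome q"
  shows "((\<lambda>l. z powi l * q powi (l*l) * qrec (q^2) (r - l) * qrec (q^2) l)
           has_sum (qpoch (-z*q) (q^2) (nat r) * qrec (q^2) r)) UNIV"
proof (rule has_sum_by_recurrence[where d = "\<lambda>r. 1 - q powi (2 * r)" and n = r])
  fix r :: int
  assume r: "r > 0"
  define f where "f r l = z powi l * q powi (l*l) * qrec (q^2) (r - l) * qrec (q^2) l" for r l
  define c where "c r = qpoch (-z*q) (q^2) (nat r) * qrec (q^2) r" for r
  assume "(f k has_sum c k) UNIV" if "k < r" for k
  then have IH: "(f (r - 1) has_sum c (r - 1)) UNIV"
    by simp
  have IH': "((\<lambda>l. f (r - 1) (l - 1)) has_sum c (r - 1)) UNIV"
    using has_sum_shift_int[of "f (r - 1)" "-1"] IH by simp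
  have q: "q \<noteq> 0" using assms by (rule nome_nonzero)
  \<comment> \<open>A q-Pascal rule, valid term by term: 1 - q^(2r) = (1 - q^(2(r-l))) + q^(2(r-l))
    (1 - q^(2l)).\<close>
  have f: "f (r - 1) l + z * q powi (2*r-1) * f (r - 1) (l - 1) = (1 - q powi (2*r)) * f r l" for l
  proof -
    \<comment> \<open>The value z = 0 is allowed. There z * z^(l-1) = z^l fails at l = 0, but
      exactly then the factor \<open>qrec (q^2) (l - 1)\<close> vanishes.\<close>
    have z: "z * z powi (l - 1) * qrec (q^2) (l - 1) = z powi l * qrec (q^2) (l - 1)"
      using power_int_minus_mult[of z l] by (cases "z = 0 \<and> l = 0") (auto simp: mult.commute)
    have a: "q powi (2*r-1) * q powi ((l-1)*(l-1)) = q powi (l*l) * q powi (2*(r-l))"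
      by (simp add: powi_add q algebra_simps)
    have b: "q powi (2*r) = q powi (2*(r-l)) * q powi (2*l)"
      by (simp add: powi_add q algebra_simps)
    have "z * q powi (2*r-1) * f (r - 1) (l - 1) = (q powi (2*r-1) * q powi ((l-1)*(l-1)))
        * (z * z powi (l - 1) * qrec (q^2) (l - 1)) * qrec (q^2) (r - l)"
      by (simp add: f_def)
    moreover have "qrec (q^2) (r - 1 - l) = (1 - q powi (2*(r-l))) * qrec (q^2) (r - l)"
      using qrec_sq_pred[OF assms, of "r - l"] by (simp add: algebra_simps)
    ultimately show ?thesis
      using qrec_sq_pred[OF assms, of l] unfolding z a b f_def by algebra
  qed
  have c: "c (r - 1) + z * q powi (2*r-1) * c (r - 1) = (1 - q powi (2*r)) * c r"
  proof -
    define n where "n = nat (r - 1)"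
    have n: "nat r = Suc n" "r = int n + 1"
      using r by (auto simp: n_def)
    have "q powi (2*r-1) = q * (q^2)^n"
      using power_int_of_nat[of q "2*n+1"] by (simp add: n(2) algebra_simps flip: power_mult)
    then have "c (r - 1) + z * q powi (2*r-1) * c (r - 1) = qpoch (-z*q) (q^2) (nat r) * qrec (q^2) (r - 1)"
      by (simp add: c_def n(1) qpoch_Suc n_def[symmetric] algebra_simps)
    then show ?thesis
      by (simp add: c_def qrec_sq_pred[OF assms])
  qed
  show "((\<lambda>l. (1 - q powi (2*r)) * f r l) has_sum (1 - q powi (2*r)) * c r) UNIV"
    using has_sum_add[OF IH has_sum_cmult_right[OF IH', of "z * q powi (2*r-1)"]] unfolding f c .
next
  show "z powi l * q powi (l*l) * qrec (q^2) (r - l) * qrec (q^2) l = 0" if "r \<le> 0" "l \<noteq> 0" for r l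
    using that by (cases "l < 0") auto
  show "z powi 0 * q powi (0*0) * qrec (q^2) (r - 0) * qrec (q^2) 0 = qpoch (-z*q) (q^2) (nat r) * qrec (q^2) r"
    if "r \<le> 0" for r
    using that by (cases "r = 0") auto
qed (use nome_powi_neq_1[OF assms] in simp)

text \<open>Coefficient of t^n in 1/((t;q^2)_inf (qt;q^2)_inf) = 1/(t;q)_inf. It serves in (2),
  where the weights of i and j differ by one factor q.\<close>

lemma has_sum_qrec_merge:
  assumes "nome q"
  shows "((\<lambda>i. q powi i * qrec (q^2) i * qrec (q^2) (n - i)) has_sum qrec q n) UNIV"
proof (rule has_sum_by_recurrence[where d = "\<lambda>n. 1 - q powi (2 * n)" and n = n])
  fix n :: int
  assume n: "n > 0"
  define f where "f n i = q powi i * qrec (q^2) i * qrec (q^2) (n - i)" for n i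
  assume "(f k has_sum qrec q k) UNIV" if "k < n" for k
  then have IH: "(f (n - 1) has_sum qrec q (n - 1)) UNIV"
    by simp
  have IH': "((\<lambda>i. f (n - 1) (n - i)) has_sum qrec q (n - 1)) UNIV"
    using has_sum_reflect_int[of "f (n - 1)" n] IH by simp
  have q: "q \<noteq> 0" using assms by (rule nome_nonzero)
  \<comment> \<open>The induction hypothesis is used twice, the second time read backwards with i
    replaced by n - i.\<close>
  have f: "f (n - 1) i + q powi n * f (n - 1) (n - i) = (1 - q powi (2*n)) * f n i" for i
  proof -
    have "q powi n * q powi (n - i) = q powi (2*(n-i)) * q powi i"
      by (simp add: powi_add q algebra_simps)
    moreover have "q powi (2*n) = q powi (2*(n-i)) * q powi (2*i)"
      by (simp add: powi_add q algebra_simps)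
    moreover have "qrec (q^2) (n - 1 - i) = (1 - q powi (2*(n-i))) * qrec (q^2) (n - i)"
      using qrec_sq_pred[OF assms, of "n - i"] by (simp add: algebra_simps)
    moreover have "f (n - 1) (n - i) = q powi (n - i) * qrec (q^2) (n - i) * ((1 - q powi (2*i)) * qrec (q^2) i)"
      unfolding f_def qrec_sq_pred[OF assms, symmetric] by simp
    ultimately show ?thesis
      unfolding f_def by algebra
  qed
  have "q powi (2*n) = q powi n * q powi n"
    by (simp add: powi_add q)
  then have c: "qrec q (n - 1) + q powi n * qrec q (n - 1) = (1 - q powi (2*n)) * qrec q n"
    using qrec_pred[OF assms, of n] by algebra
  show "((\<lambda>i. (1 - q powi (2*n)) * f n i) has_sum (1 - q powi (2*n)) * qrec q n) UNIV"
    using has_sum_add[OF IH has_sum_cmult_right[OF IH', of "q powi n"]] unfolding f c .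
next
  show "q powi i * qrec (q^2) i * qrec (q^2) (n - i) = 0" if "n \<le> 0" "i \<noteq> 0" for n i
    using that by (cases "i < 0") auto
  show "q powi 0 * qrec (q^2) 0 * qrec (q^2) (n - 0) = qrec q n" if "n \<le> 0" for n
    using that by (cases "n = 0") auto
qed (use nome_powi_neq_1[OF assms] in simp)

text \<open>In Bailey's language, (-1)^r q^(r^2), taken over all integers r, is paired with
  1/(q^2;q^2)_n relative to 1.\<close>

lemma has_sum_Gauss_finite:
  assumes "nome q"
  shows "((\<lambda>r. (-1) powi r * q powi (r*r) * qrec q (n - r) * qrec q (n + r)) has_sum qrec (q^2) n) UNIV"
proof (rule has_sum_by_recurrence[where d = "\<lambda>n. 1 - q powi (2 * n)" and n = n])
  fix n :: int
  assume n: "n > 0"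
  define f where "f n r = (-1) powi r * q powi (r*r) * qrec q (n - r) * qrec q (n + r)" for n r
  \<comment> \<open>Split by 1 - q^(n+r); after the shift of \<open>C\<close> the parts recombine by
    1 - q^(2n) = (1 - q^(n-r)) + q^(n-r) (1 - q^(n+r)).\<close>
  define A where "A r = (-1) powi r * q powi (r*r) * qrec q (n - 1 - r) * qrec q (n + r)" for r
  define C where "C r = - ((-1) powi r * q powi (r*r + r + n) * qrec q (n - 1 - r) * qrec q (n + r))" for r
  assume "(f k has_sum qrec (q^2) k) UNIV" if "k < n" for k
  then have IH: "(f (n - 1) has_sum qrec (q^2) (n - 1)) UNIV"
    by simp
  have q: "q \<noteq> 0" using assms by (rule nome_nonzero)
  have "f (n - 1) r = A r + C r" for r
  proof -
    have "qrec q (n - 1 + r) = (1 - q powi (n + r)) * qrec q (n + r)"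
      using qrec_pred[OF assms, of "n + r"] by (simp add: algebra_simps)
    moreover have "q powi (r*r + r + n) = q powi (r*r) * q powi (n + r)"
      by (simp add: powi_add q algebra_simps)
    ultimately show ?thesis
      unfolding A_def C_def f_def by algebra
  qed
  moreover have "finite {r. C r \<noteq> 0}"
    by (rule finite_subset[of _ "{-n..n}"]) (auto simp: C_def dest!: qrec_nonzero_imp)
  ultimately have "((\<lambda>r. A r + C (r - 1)) has_sum qrec (q^2) (n - 1)) UNIV"
    using IH has_sum_shift_part by (metis (no_types, lifting) ext)
  moreover have "A r + C (r - 1) = (1 - q powi (2*n)) * f n r" for r
  proof -
    have "q powi ((r-1)*(r-1) + (r-1) + n) = q powi (r*r) * q powi (n - r)"
      by (simp add: powi_add q algebra_simps)
    moreover have "qrec q (n + (r - 1)) = (1 - q powi (n + r)) * qrec q (n + r)"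
      using qrec_pred[OF assms, of "n + r"] by (simp add: algebra_simps)
    ultimately have "C (r - 1) = (-1) powi r * (q powi (r*r) * q powi (n - r)) * qrec q (n - r) * ((1 - q powi (n + r)) * qrec q (n + r))"
      by (simp add: C_def neg_one_powi_pred)
    moreover have "qrec q (n - 1 - r) = (1 - q powi (n - r)) * qrec q (n - r)"
      using qrec_pred[OF assms, of "n - r"] by (simp add: algebra_simps)
    moreover have "q powi (2*n) = q powi (n - r) * q powi (n + r)"
      by (simp add: powi_add q)
    ultimately show ?thesis
      unfolding A_def f_def by algebra
  qed
  ultimately show "((\<lambda>r. (1 - q powi (2*n)) * f n r) has_sum (1 - q powi (2*n)) * qrec (q^2) n) UNIV"
    by (simp add: qrec_sq_pred[OF assms])
next
  show "(-1) powi r * q powi (r*r) * qrec q (n - r) * qrec q (n + r) = 0" if "n \<le> 0" "r \<noteq> 0" for n r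
    using that by (cases "r < 0") auto
  show "(-1) powi 0 * q powi (0*0) * qrec q (n - 0) * qrec q (n + 0) = qrec (q^2) n" if "n \<le> 0" for n
    using that by (cases "n = 0") auto
qed (use nome_powi_neq_1[OF assms] in simp)

section \<open>Infinite products and limits\<close>

lemma convergent_prod_qpoch:
  assumes "norm (p::complex) < 1"
  shows "convergent_prod (\<lambda>n. 1 - a * p ^ n)"
proof (intro abs_convergent_prod_imp_convergent_prod summable_imp_abs_convergent_prod)
  show "summable (\<lambda>n. norm (1 - a * p ^ n - 1))"
    using assms by (auto simp: norm_mult norm_power intro!: summable_mult summable_geometric)
qed

lemma qpoch_LIMSEQ:
  assumes "norm p < 1"
  shows "qpoch a p \<longlonglongrightarrow> qpoch_inf a p"
  using convergent_prod_LIMSEQ[OF convergent_prod_qpoch[OF assms, of a]]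
  unfolding qpoch_def[abs_def] qpoch_inf_def by (simp add: LIMSEQ_lessThan_iff_atMost)

lemma qpoch_inf_nonzero:
  assumes "norm p < 1" and "norm a < 1"
  shows "qpoch_inf a p \<noteq> 0"
  unfolding qpoch_inf_def
proof (rule prodinf_nonzero[OF convergent_prod_qpoch[OF assms(1)]])
  fix n
  have "norm (a * p ^ n) \<le> norm a * 1"
    unfolding norm_mult norm_power by (intro mult_left_mono power_le_one) (use assms in auto)
  then show "1 - a * p ^ n \<noteq> 0"
    using assms(2) by auto
qed

lemma qpoch_add: "qpoch a p (n + m) = qpoch a p n * qpoch (a * p ^ n) p m"
  by (induction m) (simp_all add: qpoch_Suc power_add mult.assoc)

lemma qpoch_inf_shift:
  assumes "norm p < 1"
  shows "qpoch_inf a p = qpoch a p n * qpoch_inf (a * p ^ n) p"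
proof (rule LIMSEQ_unique)
  show "(\<lambda>m. qpoch a p (m + n)) \<longlonglongrightarrow> qpoch_inf a p"
    by (rule LIMSEQ_ignore_initial_segment[OF qpoch_LIMSEQ[OF assms]])
  show "(\<lambda>m. qpoch a p (m + n)) \<longlonglongrightarrow> qpoch a p n * qpoch_inf (a * p ^ n) p"
    by (subst add.commute, subst qpoch_add) (intro tendsto_mult tendsto_const qpoch_LIMSEQ[OF assms])
qed

lemma qpoch_double: "qpoch a p (2 * n) = qpoch a (p^2) n * qpoch (a * p) (p^2) n"
  by (induction n) (simp_all add: qpoch_Suc power_mult[symmetric] mult.assoc)

lemma qpoch_inf_parity:
  assumes "norm p < 1"
  shows "qpoch_inf a p = qpoch_inf a (p^2) * qpoch_inf (a * p) (p^2)"
proof (rule LIMSEQ_unique)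
  have p2: "norm (p^2) < 1"
    using assms by (simp add: norm_power power_less_one_iff)
  show "(\<lambda>n. qpoch a p (2 * n)) \<longlonglongrightarrow> qpoch_inf a p"
    using LIMSEQ_subseq_LIMSEQ[OF qpoch_LIMSEQ[OF assms], of "\<lambda>n. 2 * n"]
    by (simp add: strict_mono_def o_def)
  show "(\<lambda>n. qpoch a p (2 * n)) \<longlonglongrightarrow> qpoch_inf a (p^2) * qpoch_inf (a * p) (p^2)"
    unfolding qpoch_double by (intro tendsto_mult qpoch_LIMSEQ[OF p2])
qed

lemma qpoch_inf_square:
  assumes "norm p < 1"
  shows "qpoch_inf (a^2) (p^2) = qpoch_inf a p * qpoch_inf (-a) p"
  unfolding qpoch_inf_def
  by (subst prodinf_mult[OF convergent_prod_qpoch[OF assms] convergent_prod_qpoch[OF assms]])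
     (simp add: algebra_simps power2_eq_square power_mult_distrib)

lemma qpoch_inf_square_4:
  assumes q: "nome q"
  shows "qpoch_inf (q^4) (q^4) = qpoch_inf (q^2) (q^2) * qpoch_inf (-(q^2)) (q^2)"
  using qpoch_inf_square[OF nome_norm[OF nome_power[OF q, of 2]], of "q^2"] by (simp flip: power_mult)

lemma qpoch_inf_neg_square_nonzero:
  assumes q: "nome q"
  shows "qpoch_inf (-(q^2)) (q^2) \<noteq> 0"
  using nome_norm[OF nome_power[OF q, of 2]] by (intro qpoch_inf_nonzero) auto

lemma qpoch_inf_self_nonzero: "nome p \<Longrightarrow> qpoch_inf p p \<noteq> 0"
  by (rule qpoch_inf_nonzero) (auto simp: nome_def)

text \<open>The first 2n factors are split off and sorted by parity. This trades the tail in the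
  reduced sums, which varies with the summation index, for the constant (-q^2;q^2)_inf.\<close>

lemma qpoch_inf_neg_square_shift:
  assumes q: "nome q"
  shows "qpoch_inf (-(q^2)) (q^2) = qpoch (-(q^2)) (q^4) n * qpoch (-(q^4)) (q^4) n * qpoch_inf (-(q^2 * q^(4*n))) (q^2)"
proof -
  have "qpoch_inf (-(q^2)) (q^2) = qpoch (-(q^2)) (q^2) (2*n) * qpoch_inf (-(q^2) * (q^2)^(2*n)) (q^2)"
    using nome_power[OF q, of 2] by (intro qpoch_inf_shift) (auto simp: nome_def)
  also have "qpoch (-(q^2)) (q^2) (2*n) = qpoch (-(q^2)) (q^4) n * qpoch (-(q^4)) (q^4) n"
    by (simp add: qpoch_double flip: power_mult power_add)
  finally show ?thesis
    by (simp flip: power_mult)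
qed

lemma qrec_LIMSEQ:
  assumes "nome p"
  shows "(\<lambda>n. qrec p (int n + k)) \<longlonglongrightarrow> 1 / qpoch_inf p p"
proof -
  have "(\<lambda>n. 1 / qpoch p p n) \<longlonglongrightarrow> 1 / qpoch_inf p p"
    using qpoch_inf_self_nonzero[OF assms] assms
    by (intro tendsto_divide tendsto_const qpoch_LIMSEQ) (auto simp: nome_def)
  then have "(\<lambda>n. qrec p (int n)) \<longlonglongrightarrow> 1 / qpoch_inf p p"
    by (simp add: qrec_of_nat)
  then have "(\<lambda>n. qrec p (int (n + nat k))) \<longlonglongrightarrow> 1 / qpoch_inf p p"
    by (rule LIMSEQ_ignore_initial_segment)
  then have "(\<lambda>n. qrec p (int (n + nat (- k)) + k)) \<longlonglongrightarrow> 1 / qpoch_inf p p"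
    by (cases "k \<ge> 0") (simp_all add: algebra_simps \<open>(\<lambda>n. qrec p (int n)) \<longlonglongrightarrow> _\<close>)
  then show ?thesis
    by (rule LIMSEQ_offset)
qed

lemma qrec_bounded:
  assumes "nome p"
  obtains K where "K > 0" "\<And>n. norm (qrec p n) \<le> K"
proof -
  have "Bseq (\<lambda>n. qrec p (int n))"
    using qrec_LIMSEQ[OF assms, of 0] by (intro convergent_imp_Bseq convergentI) simp
  then obtain K where K: "K > 0" "\<And>n. norm (qrec p (int n)) \<le> K"
    by (auto elim: BseqE)
  have "norm (qrec p n) \<le> K" for n
    using K by (cases n rule: int_cases2) (auto, metis K(1) less_le norm_zero of_nat_0_le_iff qrec_neg
      neg_0_le_iff_le linorder_not_le K(2) minus_zero)
  then show thesis
    using that K(1) by blast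
qed

section \<open>Series as limits of finite convolutions\<close>

lemma has_sum_int_nat:
  fixes f :: "int \<Rightarrow> complex"
  assumes "\<And>n. n < 0 \<Longrightarrow> f n = 0"
  shows "((\<lambda>n::nat. f (int n)) has_sum S) UNIV \<longleftrightarrow> (f has_sum S) UNIV"
proof -
  have "((\<lambda>n::nat. f (int n)) has_sum S) UNIV \<longleftrightarrow> (f has_sum S) (range int)"
    by (subst has_sum_reindex) (auto simp: o_def)
  also have "\<dots> \<longleftrightarrow> (f has_sum S) UNIV"
  proof (rule has_sum_cong_neutral)
    show "f n = 0" if "n \<in> UNIV - range int" for n
      using that assms[of n] nonneg_int_cases[of n] by (cases "n < 0") auto
  qed auto
  finally show ?thesis .
qed

lemma summable_on_int_nat:
  fixes f :: "int \<Rightarrow> complex"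
  assumes "\<And>n. n < 0 \<Longrightarrow> f n = 0"
  shows "(\<lambda>n::nat. f (int n)) summable_on UNIV \<longleftrightarrow> f summable_on UNIV"
  unfolding summable_on_def using has_sum_int_nat[of f, OF assms] by simp

text \<open>For fixed l the factor \<open>qrec p (int r - l)\<close> tends to 1/(p;p)_inf and stays
  bounded, so Tannery's theorem moves the limit inside the sum. Finite identities become series this
  way.\<close>

lemma has_sum_convolution_limit:
  fixes g :: "int \<Rightarrow> complex"
  assumes p: "nome p" and g: "\<And>l. l < 0 \<Longrightarrow> g l = 0" "g summable_on UNIV"
    and c: "\<And>r. ((\<lambda>l. g l * qrec p (int r - l)) has_sum c r) UNIV" "c \<longlonglongrightarrow> L"
  shows "(g has_sum L * qpoch_inf p p) UNIV"
proof -
  obtain K where K: "K > 0" "\<And>n. norm (qrec p n) \<le> K"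
    using qrec_bounded[OF p] by blast
  have gs: "(\<lambda>k. norm (g (int k))) summable_on UNIV"
    using g(2) summable_on_int_nat[of g] g(1) by (simp add: summable_on_iff_abs_summable_on_complex)
  define a where "a k r = g (int k) * qrec p (int r - int k)" for k r
  define b where "b k = g (int k) * (1 / qpoch_inf p p)" for k
  have "(\<lambda>r. \<Sum>k. a k r) \<longlonglongrightarrow> suminf b"
  proof (rule tannerys_theorem[where M = "\<lambda>k. norm (g (int k)) * K", THEN conjunct2, THEN conjunct2])
    show "(\<lambda>r. a k r) \<longlonglongrightarrow> b k" for k
      unfolding a_def b_def using qrec_LIMSEQ[OF p, of "- int k"] by (intro tendsto_intros) simp
    show "\<forall>\<^sub>F (k, r) in sequentially \<times>\<^sub>F sequentially. norm (a k r) \<le> norm (g (int k)) * K"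
      by (rule always_eventually) (auto simp: a_def norm_mult intro!: mult_left_mono K)
    show "summable (\<lambda>k. norm (g (int k)) * K)"
      by (intro summable_mult2 summable_on_imp_summable gs)
  qed simp
  moreover have "(\<Sum>k. a k r) = c r" for r
  proof -
    have "((\<lambda>k. a k r) has_sum c r) UNIV"
      unfolding a_def using has_sum_int_nat[of "\<lambda>l. g l * qrec p (int r - l)"] c(1)[of r] g(1) by simp
    then show ?thesis
      using has_sum_imp_sums sums_unique by metis
  qed
  ultimately have "suminf b = L"
    using c(2) LIMSEQ_unique by simp
  have "((\<lambda>k. g (int k)) has_sum infsum g UNIV) UNIV"
    using g by (simp add: has_sum_int_nat)
  then have "b sums (infsum g UNIV * (1 / qpoch_inf p p))"
    unfolding b_def by (intro sums_mult2 has_sum_imp_sums)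
  then have "infsum g UNIV * (1 / qpoch_inf p p) = L"
    using \<open>suminf b = L\<close> sums_unique by metis
  then have "infsum g UNIV = L * qpoch_inf p p"
    using qpoch_inf_self_nonzero[OF p] by (auto simp: field_simps)
  then show ?thesis
    using has_sum_infsum[OF g(2)] by simp
qed

text \<open>The term is the n-th power of R rho^n, which is eventually below 1/2.\<close>

lemma summable_gaussian:
  fixes R \<rho> :: real
  assumes "R \<ge> 0" "0 \<le> \<rho>" "\<rho> < 1"
  shows "(\<lambda>n::nat. R ^ n * \<rho> ^ n\<^sup>2) summable_on UNIV"
proof (rule summable_nonneg_imp_summable_on)
  have "(\<lambda>n. R * \<rho> ^ n) \<longlonglongrightarrow> R * 0"
    using assms by (intro tendsto_mult tendsto_const LIMSEQ_realpow_zero)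
  then have "\<forall>\<^sub>F n in sequentially. R * \<rho> ^ n < 1 / 2"
    by (rule order_tendstoD) simp
  then obtain N where N: "\<And>n. n \<ge> N \<Longrightarrow> R * \<rho> ^ n < 1 / 2"
    by (auto simp: eventually_sequentially)
  show "summable (\<lambda>n. R ^ n * \<rho> ^ n\<^sup>2)"
  proof (rule summable_comparison_test'[of "\<lambda>n. (1/2::real) ^ n" N])
    show "summable (\<lambda>n. (1/2::real) ^ n)"
      by (rule summable_geometric) simp
    fix n assume "n \<ge> N"
    have "norm (R ^ n * \<rho> ^ n\<^sup>2) = (R * \<rho> ^ n) ^ n"
      using assms by (simp add: power_mult_distrib power2_eq_square power_mult)
    also have "\<dots> \<le> (1/2) ^ n"
      using N[OF \<open>n \<ge> N\<close>] assms by (intro power_mono) auto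
    finally show "norm (R ^ n * \<rho> ^ n\<^sup>2) \<le> (1/2) ^ n" .
  qed
qed (use assms in simp)

text \<open>The limit of \<open>has_sum_q_binomial\<close> as r tends to infinity.\<close>

lemma has_sum_Euler:
  assumes "nome q"
  shows "((\<lambda>n. z powi n * q powi (n*n) * qrec (q^2) n) has_sum qpoch_inf (-z*q) (q^2)) UNIV"
proof -
  define g where "g n = z powi n * q powi (n*n) * qrec (q^2) n" for n
  have q2: "nome (q^2)"
    using nome_power[OF assms] by simp
  obtain K where K: "K > 0" "\<And>n. norm (qrec (q^2) n) \<le> K"
    using qrec_bounded[OF q2] by blast
  have "(\<lambda>n. g (int n)) summable_on UNIV"
  proof (rule abs_summable_summable, rule summable_on_comparison_test)
    show "(\<lambda>n. K * (norm z ^ n * norm q ^ n\<^sup>2)) summable_on UNIV"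
      using assms by (intro summable_on_cmult_right summable_gaussian) (auto simp: nome_def)
    fix n
    have "q powi (int n * int n) = q ^ n\<^sup>2"
      by (simp add: power2_eq_square flip: of_nat_mult)
    then have "norm (g (int n)) = norm z ^ n * norm q ^ n\<^sup>2 * norm (qrec (q^2) (int n))"
      by (simp add: g_def norm_mult norm_power)
    also have "\<dots> \<le> norm z ^ n * norm q ^ n\<^sup>2 * K"
      by (intro mult_left_mono K) auto
    finally show "norm (g (int n)) \<le> K * (norm z ^ n * norm q ^ n\<^sup>2)"
      by (simp add: mult_ac)
  qed auto
  then have "g summable_on UNIV"
    by (subst (asm) summable_on_int_nat) (auto simp: g_def)
  moreover have "((\<lambda>l. g l * qrec (q^2) (int r - l)) has_sum (qpoch (-z*q) (q^2) r * qrec (q^2) (int r))) UNIV" for r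
    using has_sum_q_binomial[OF assms, of z "int r"] by (simp add: g_def mult_ac)
  moreover have "(\<lambda>r. qpoch (-z*q) (q^2) r * qrec (q^2) (int r))
      \<longlonglongrightarrow> qpoch_inf (-z*q) (q^2) * (1 / qpoch_inf (q^2) (q^2))"
    using qrec_LIMSEQ[OF q2, of 0] q2 by (intro tendsto_mult qpoch_LIMSEQ) (auto simp: nome_def)
  ultimately have "(g has_sum (qpoch_inf (-z*q) (q^2) * (1 / qpoch_inf (q^2) (q^2)) * qpoch_inf (q^2) (q^2))) UNIV"
    by (intro has_sum_convolution_limit[OF q2]) (auto simp: g_def)
  then show ?thesis
    using qpoch_inf_self_nonzero[OF q2] by (simp add: g_def[abs_def])
qed

text \<open>The limit of \<open>has_sum_q_Vandermonde\<close> as M and N tend to infinity with N - M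
  = k, summed over s = M - m. For k = 0 it sorts partitions by their Durfee square.\<close>

lemma has_sum_Durfee:
  assumes "nome p"
  shows "((\<lambda>s. p powi (s*(s+k)) * qrec p s * qrec p (s+k)) has_sum (1 / qpoch_inf p p)) UNIV"
proof -
  \<comment> \<open>For nonnegative k the exponent is at least s^2, so a Gaussian majorant applies.
    Negative k follows by replacing s with s - k, as the summand is symmetric in s and s +
    k.\<close>
  have *: "((\<lambda>s. p powi (s*(s+k)) * qrec p s * qrec p (s+k)) has_sum (1 / qpoch_inf p p)) UNIV" if "k \<ge> 0" for k
  proof -
    define g where "g s = p powi (s*(s+k)) * qrec p s * qrec p (s+k)" for s
    obtain K where K: "K > 0" "\<And>n. norm (qrec p n) \<le> K"
      using qrec_bounded[OF assms] by blast
    have "(\<lambda>n. g (int n)) summable_on UNIV"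
    proof (rule abs_summable_summable, rule summable_on_comparison_test)
      show "(\<lambda>n. K * K * (1 ^ n * norm p ^ n\<^sup>2)) summable_on UNIV"
        using assms by (intro summable_on_cmult_right summable_gaussian) (auto simp: nome_def)
      fix n
      have "int n * (int n + k) = int (n\<^sup>2 + n * nat k)"
        using that by (simp add: power2_eq_square algebra_simps)
      then have "norm (p powi (int n * (int n + k))) = norm p ^ (n\<^sup>2 + n * nat k)"
        by (simp only: power_int_of_nat norm_power)
      also have "\<dots> \<le> norm p ^ n\<^sup>2"
        using assms by (intro power_decreasing) (auto simp: nome_def)
      finally have "norm (g (int n)) \<le> norm p ^ n\<^sup>2 * K * K"
        unfolding g_def norm_mult by (intro mult_mono K) (use K(1) in auto)
      then show "norm (g (int n)) \<le> K * K * (1 ^ n * norm p ^ n\<^sup>2)"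
        by (simp add: mult_ac)
    qed auto
    then have "g summable_on UNIV"
      by (subst (asm) summable_on_int_nat) (auto simp: g_def)
    moreover have "((\<lambda>s. g s * qrec p (int r - s)) has_sum (qrec p (int r + 0) * qrec p (int r + k))) UNIV" for r
      using has_sum_q_Vandermonde[OF assms, of "int r" "int r + k"]
        has_sum_reflect_int[of "\<lambda>m. p powi ((int r - m) * (int r + k - m)) * qrec p (int r - m) * qrec p (int r + k - m) * qrec p m" "int r"]
      by (simp add: g_def algebra_simps)
    moreover have "(\<lambda>r. qrec p (int r + 0) * qrec p (int r + k)) \<longlonglongrightarrow> 1 / qpoch_inf p p * (1 / qpoch_inf p p)"
      by (intro tendsto_mult qrec_LIMSEQ[OF assms])
    ultimately have "(g has_sum (1 / qpoch_inf p p * (1 / qpoch_inf p p) * qpoch_inf p p)) UNIV"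
      by (intro has_sum_convolution_limit[OF assms]) (auto simp: g_def)
    then show ?thesis
      using qpoch_inf_self_nonzero[OF assms] by (simp add: g_def[abs_def])
  qed
  show ?thesis
  proof (cases "k \<ge> 0")
    case False
    have "((\<lambda>s. p powi ((s-k)*(s-k+k)) * qrec p (s-k) * qrec p (s-k+k)) has_sum (1 / qpoch_inf p p)) UNIV"
      using *[of "-k"] False by (simp add: mult_ac)
    then show ?thesis
      using has_sum_shift_int[of "\<lambda>s. p powi (s*(s+k)) * qrec p s * qrec p (s+k)" "-k"] by simp
  qed (rule *)
qed

section \<open>Products and fibrewise summation of multiple series\<close>

lemma has_sum_times:
  fixes f :: "'a \<Rightarrow> complex" and g :: "'b \<Rightarrow> complex"
  assumes "(f has_sum a) UNIV" "(g has_sum b) UNIV"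
  shows "((\<lambda>(x, y). f x * g y) has_sum (a * b)) UNIV"
proof -
  define F where "F = (\<lambda>(x, y). f x * g y)"
  have "(\<lambda>z. norm (F z)) summable_on (UNIV \<times> UNIV)"
  proof (subst Infinite_Sum.abs_summable_on_Sigma_iff, intro conjI ballI)
    have fs: "(\<lambda>x. norm (f x)) summable_on UNIV" and gs: "(\<lambda>y. norm (g y)) summable_on UNIV"
      using assms has_sum_imp_summable summable_on_iff_abs_summable_on_complex by blast+
    show "(\<lambda>y. norm (F (x, y))) summable_on UNIV" for x
      using gs by (simp add: F_def norm_mult summable_on_cmult_right)
    show "(\<lambda>x. norm (infsum (\<lambda>y. norm (F (x, y))) UNIV)) summable_on UNIV"
      using fs by (simp add: F_def norm_mult infsum_cmult_right' abs_mult summable_on_cmult_left)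
  qed
  then have "F summable_on (UNIV \<times> UNIV)"
    by (rule abs_summable_summable)
  then have "(F has_sum (a * b)) (UNIV \<times> UNIV)"
    by (intro has_sum_SigmaI[where g = "\<lambda>x. f x * b"])
       (auto simp: F_def intro!: has_sum_cmult_right has_sum_cmult_left assms)
  then show ?thesis
    by (simp add: F_def)
qed

text \<open>Fubini after a bijective change of index; joint summability is what leads from the
  iterated sum back to the full one. Being an equivalence for every S, it also hands summability on
  to the next stage of a chain.\<close>

lemma has_sum_fibers:
  fixes f :: "'c \<Rightarrow> complex" and h :: "'a \<times> 'b \<Rightarrow> 'c"
  assumes "\<And>x. h (h' x) = x" "\<And>y. h' (h y) = y"
    and "f summable_on UNIV"
    and "\<And>a. ((\<lambda>b. f (h (a, b))) has_sum g a) UNIV"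
  shows "(f has_sum S) UNIV \<longleftrightarrow> (g has_sum S) UNIV"
proof -
  have h: "bij h"
    using assms(1,2) by (intro o_bij[of h']) auto
  have "(f has_sum S) UNIV \<longleftrightarrow> ((\<lambda>x. f (h x)) has_sum S) (UNIV \<times> UNIV)"
    using has_sum_reindex_bij_betw[OF h, of f S] by simp
  also have "\<dots> \<longleftrightarrow> (g has_sum S) UNIV"
  proof
    assume "((\<lambda>x. f (h x)) has_sum S) (UNIV \<times> UNIV)"
    then show "(g has_sum S) UNIV"
      by (rule has_sum_SigmaD) (rule assms(4))
  next
    assume "(g has_sum S) UNIV"
    moreover have "(\<lambda>x. f (h x)) summable_on (UNIV \<times> UNIV)"
      using assms(3) summable_on_reindex_bij_betw[OF h, of f] by simp
    ultimately show "((\<lambda>x. f (h x)) has_sum S) (UNIV \<times> UNIV)"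
      by (intro has_sum_SigmaI[OF assms(4)]) auto
  qed
  finally show ?thesis .
qed

text \<open>Euler's series in z and in 1/z are multiplied and collected along k = M - N. Since
  (N+k)^2 + N^2 = k^2 + 2N(N+k), the inner sum over N is a Durfee series, whose value is the same
  for every k.\<close>

lemma Jacobi_triple_product:
  assumes "nome q" "z \<noteq> 0"
  shows "((\<lambda>k. z powi k * q powi (k*k)) has_sum
    (qpoch_inf (-z*q) (q^2) * qpoch_inf (-q/z) (q^2) * qpoch_inf (q^2) (q^2))) UNIV"
proof -
  have q: "q \<noteq> 0" and q2: "nome (q^2)"
    using nome_power[OF assms(1)] nome_nonzero[OF assms(1)] by auto
  define f where "f = (\<lambda>(M::int, N::int). (z powi M * q powi (M*M) * qrec (q^2) M) * ((1/z) powi N * q powi (N*N) * qrec (q^2) N))"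
  have f: "(f has_sum (qpoch_inf (-z*q) (q^2) * qpoch_inf (-(1/z)*q) (q^2))) UNIV"
    unfolding f_def by (intro has_sum_times has_sum_Euler assms)
  have "((\<lambda>k. z powi k * q powi (k*k) * (1 / qpoch_inf (q^2) (q^2))) has_sum
      (qpoch_inf (-z*q) (q^2) * qpoch_inf (-(1/z)*q) (q^2))) UNIV"
  proof (rule has_sum_fibers[where f = f and h = "\<lambda>(k, N). (N + k, N)" and h' = "\<lambda>(M, N). (M - N, N)", THEN iffD1])
    show "((\<lambda>N. f (case (k, N) of (k, N) \<Rightarrow> (N + k, N))) has_sum
        (z powi k * q powi (k*k) * (1 / qpoch_inf (q^2) (q^2)))) UNIV" for k
    proof -
      have "f (N + k, N) = z powi k * q powi (k*k) * ((q^2) powi (N*(N+k)) * qrec (q^2) N * qrec (q^2) (N+k))" for N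
      proof -
        have "z powi (N + k) * (1/z) powi N = z powi k"
          using assms(2) by (simp add: power_int_add power_int_one_over)
        moreover have "q powi ((N+k)*(N+k)) * q powi (N*N) = q powi (k*k) * (q^2) powi (N*(N+k))"
          by (simp add: power_int_power powi_add q algebra_simps)
        moreover have "f (N + k, N) = (z powi (N + k) * (1/z) powi N) * (q powi ((N+k)*(N+k)) * q powi (N*N))
            * (qrec (q^2) N * qrec (q^2) (N+k))"
          by (simp add: f_def mult_ac)
        ultimately show ?thesis
          by (simp only: mult.assoc)
      qed
      then show ?thesis
        using has_sum_cmult_right[OF has_sum_Durfee[OF q2, of k]] by simp
    qed
  qed (use f has_sum_imp_summable in auto)
  from has_sum_cmult_left[OF this, of "qpoch_inf (q^2) (q^2)"] show ?thesis
    using qpoch_inf_self_nonzero[OF q2] by (simp add: mult_ac)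
qed

section \<open>Reduction of the quadruple sums\<close>

lemma summable_on_times:
  fixes f :: "'a \<Rightarrow> complex" and g :: "'b \<Rightarrow> complex"
  assumes "f summable_on UNIV" "g summable_on UNIV"
  shows "(\<lambda>(x, y). f x * g y) summable_on UNIV"
  using has_sum_times[OF has_sum_infsum[OF assms(1)] has_sum_infsum[OF assms(2)]] by (rule has_sum_imp_summable)

lemma has_sum_nat_quad:
  fixes f :: "int \<times> int \<times> int \<times> int \<Rightarrow> complex"
  assumes "\<And>i j k l. i < 0 \<or> j < 0 \<or> k < 0 \<or> l < 0 \<Longrightarrow> f (i, j, k, l) = 0"
  shows "((\<lambda>(i, j, k, l). f (int i, int j, int k, int l)) has_sum S) UNIV \<longleftrightarrow> (f has_sum S) UNIV"
proof -
  define h where "h = (\<lambda>(i, j, k, l). (int i, int j, int k, int l))"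
  have "inj h"
    by (auto simp: inj_def h_def)
  then have "((\<lambda>x. f (h x)) has_sum S) UNIV \<longleftrightarrow> (f has_sum S) (range h)"
    by (simp add: has_sum_reindex o_def)
  also have "\<dots> \<longleftrightarrow> (f has_sum S) UNIV"
  proof (rule has_sum_cong_neutral)
    show "f x = 0" if "x \<in> UNIV - range h" for x
    proof (rule ccontr)
      assume "f x \<noteq> 0"
      obtain i j k l where x: "x = (i, j, k, l)"
        by (cases x) auto
      have "i \<ge> 0" "j \<ge> 0" "k \<ge> 0" "l \<ge> 0"
        using assms[of i j k l] \<open>f x \<noteq> 0\<close> x by force+
      then have "x = h (nat i, nat j, nat k, nat l)"
        by (simp add: h_def x)
      then show False
        using that by blast
    qed
  qed auto
  finally show ?thesis
    by (simp add: h_def case_prod_unfold)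
qed

text \<open>The weight \<open>c\<close> is a parameter because the nine series differ in nothing
  else. Indices are integers, and \<open>qrec\<close> confines the support to nonnegative
  ones.\<close>

definition quad_term ::
    "complex \<Rightarrow> (int \<Rightarrow> int \<Rightarrow> int \<Rightarrow> int \<Rightarrow> complex) \<Rightarrow> int \<times> int \<times> int \<times> int \<Rightarrow> complex" where
  "quad_term q c = (\<lambda>(i, j, k, l). c i j k l * q powi ((i + j + k + 2*l)^2 + 2 * l^2) *
     (qrec (q^2) i * qrec (q^2) j * qrec (q^2) k * qrec (q^4) l))"

lemma quad_term_nat:
  "quad_term q c (int i, int j, int k, int l) =
     c (int i) (int j) (int k) (int l) * q ^ quadQ i j k l / denomD q i j k l"
proof -
  have "(int i + int j + int k + 2 * int l)^2 + 2 * (int l)^2 = int (quadQ i j k l)"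
    by (simp add: quadQ_def power2_eq_square algebra_simps)
  then show ?thesis
    by (simp add: quad_term_def denomD_def qrec_of_nat)
qed

lemma has_sum_quad_term:
  "((\<lambda>(i, j, k, l). c (int i) (int j) (int k) (int l) * q ^ quadQ i j k l / denomD q i j k l) has_sum S) UNIV
     \<longleftrightarrow> (quad_term q c has_sum S) UNIV"
  by (subst has_sum_nat_quad[symmetric]) (auto simp: quad_term_def simp flip: quad_term_nat)

text \<open>Q dominates i^2 + j^2 + k^2 + l^2, so for a monomial weight a product of four Gaussian
  series is a majorant.\<close>

lemma summable_quad_term:
  assumes q: "nome q"
    and c: "\<And>i j k l. c (int i) (int j) (int k) (int l) = x ^ i * y ^ j * z ^ k * w ^ l"
  shows "quad_term q c summable_on UNIV"
proof -
  obtain K where K: "K > 0" "\<And>n. norm (qrec (q^2) n) \<le> K"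
    using qrec_bounded[OF nome_power[OF q, of 2]] by auto
  obtain L where L: "L > 0" "\<And>n. norm (qrec (q^4) n) \<le> L"
    using qrec_bounded[OF nome_power[OF q, of 4]] by auto
  define R where "R = norm x + norm y + norm z + norm w"
  define G where "G n = R ^ n * norm q ^ n\<^sup>2" for n :: nat
  have R: "norm x \<le> R" "norm y \<le> R" "norm z \<le> R" "norm w \<le> R" "R \<ge> 0"
    by (auto simp: R_def)
  \<comment> \<open>The product rule \<open>summable_on_times\<close> is stated over the complex
    numbers; the real majorant is recovered by taking real parts.\<close>
  have 1: "(\<lambda>n. complex_of_real (G n)) summable_on UNIV"
    unfolding G_def using q R by (intro summable_on_of_real summable_gaussian) (auto simp: nome_def)
  have "(\<lambda>(i, j, k, l). complex_of_real (G i * (G j * (G k * G l)))) summable_on UNIV"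
    using summable_on_times[OF 1 summable_on_times[OF 1 summable_on_times[OF 1 1]]]
    by (simp add: case_prod_unfold)
  then have "(\<lambda>t. complex_of_real (case t of (i, j, k, l) \<Rightarrow> G i * (G j * (G k * G l)))) summable_on UNIV"
    by (simp add: case_prod_unfold)
  then have "(\<lambda>(i, j, k, l). G i * (G j * (G k * G l))) summable_on UNIV"
    using summable_on_Re by fastforce
  then have "(\<lambda>t. K * K * K * L * (case t of (i, j, k, l) \<Rightarrow> G i * (G j * (G k * G l)))) summable_on UNIV"
    by (rule summable_on_cmult_right)
  then have "(\<lambda>(i, j, k, l). K * K * K * L * (G i * (G j * (G k * G l)))) summable_on UNIV"
    by (simp add: case_prod_unfold)
  then have "(\<lambda>x. norm (case x of (i, j, k, l) \<Rightarrow> quad_term q c (int i, int j, int k, int l))) summable_on UNIV"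
  proof (rule summable_on_comparison_test)
    fix t :: "nat \<times> nat \<times> nat \<times> nat"
    obtain i j k l where t: "t = (i, j, k, l)"
      by (cases t) auto
    have "norm (q ^ quadQ i j k l) \<le> norm q ^ (i\<^sup>2 + j\<^sup>2 + k\<^sup>2 + l\<^sup>2)"
      unfolding norm_power using q by (intro power_decreasing) (auto simp: nome_def quadQ_def)
    moreover have "norm (x ^ i * y ^ j * z ^ k * w ^ l) \<le> R ^ i * R ^ j * R ^ k * R ^ l"
      unfolding norm_mult norm_power using R by (intro mult_mono power_mono) auto
    moreover have "norm (1 / denomD q i j k l) \<le> K * K * K * L"
    proof -
      have e: "1 / denomD q i j k l = qrec (q^2) (int i) * qrec (q^2) (int j) * qrec (q^2) (int k) * qrec (q^4) (int l)"
        by (simp add: denomD_def qrec_of_nat)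
      show ?thesis
        unfolding e norm_mult by (intro mult_mono K L) (use K(1) L(1) in auto)
    qed
    ultimately have "norm (x ^ i * y ^ j * z ^ k * w ^ l) * norm (q ^ quadQ i j k l) * norm (1 / denomD q i j k l)
        \<le> (R ^ i * R ^ j * R ^ k * R ^ l) * norm q ^ (i\<^sup>2 + j\<^sup>2 + k\<^sup>2 + l\<^sup>2) * (K * K * K * L)"
      using R K(1) L(1) by (intro mult_mono) auto
    then show "norm (case t of (i, j, k, l) \<Rightarrow> quad_term q c (int i, int j, int k, int l))
       \<le> (case t of (i, j, k, l) \<Rightarrow> K * K * K * L * (G i * (G j * (G k * G l))))"
      by (simp add: t quad_term_nat c G_def norm_mult norm_divide power_add mult_ac)
  qed auto
  then have "(\<lambda>(i, j, k, l). quad_term q c (int i, int j, int k, int l)) summable_on UNIV"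
    by (rule abs_summable_summable)
  then show ?thesis
    unfolding summable_on_def by (subst (asm) has_sum_nat_quad) (auto simp: quad_term_def)
qed

text \<open>Q and D are symmetric in i, j, k, so a permutation of these indices acts on the weight
  alone.\<close>

lemma has_sum_quad_swap_ij:
  "(quad_term q (\<lambda>i j k l. c j i k l) has_sum S) UNIV \<longleftrightarrow> (quad_term q c has_sum S) UNIV"
  by (rule has_sum_reindex_bij_witness[of _ "\<lambda>(i, j, k, l). (j, i, k, l)" "\<lambda>(i, j, k, l). (j, i, k, l)"])
     (auto simp: quad_term_def algebra_simps)

lemma has_sum_quad_swap_jk:
  "(quad_term q (\<lambda>i j k l. c i k j l) has_sum S) UNIV \<longleftrightarrow> (quad_term q c has_sum S) UNIV"
  by (rule has_sum_reindex_bij_witness[of _ "\<lambda>(i, j, k, l). (i, k, j, l)" "\<lambda>(i, j, k, l). (i, k, j, l)"])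
     (auto simp: quad_term_def algebra_simps)

lemma quad_term_cmult: "quad_term q (\<lambda>i j k l. x * c i j k l) t = x * quad_term q c t"
  by (simp add: quad_term_def case_prod_unfold mult.assoc)

text \<open>The hypothesis on \<open>c\<close> is the condition w q^2 = -z^2 in coefficient form: up
  to (-1)^l q^(-2l), the weight sees k and l only through m = k + 2l. For fixed m the sum over l is
  \<open>has_sum_qrec_cancel\<close>, which contributes the exponent m^2 - m.\<close>

lemma has_sum_reduce_kl:
  assumes q: "nome q"
    and c: "\<And>i j k l. c i j k l = b i j (k + 2*l) * ((-1) powi l * q powi (- 2*l))"
    and summ: "quad_term q c summable_on UNIV"
  shows "(quad_term q c has_sum S) UNIV \<longleftrightarrow>
    ((\<lambda>(i, j, m). b i j m * q powi ((i + j + m)^2 + m^2 - m) * (qrec (q^2) i * qrec (q^2) j * qrec (q^2) m)) has_sum S) UNIV"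
proof (rule has_sum_fibers[where h = "\<lambda>((i, j, m), l). (i, j, m - 2*l, l)" and h' = "\<lambda>(i, j, k, l). ((i, j, k + 2*l), l)"])
  fix t :: "int \<times> int \<times> int"
  obtain i j m where t: "t = (i, j, m)"
    by (cases t) auto
  have "quad_term q c (i, j, m - 2*l, l) = b i j m * q powi ((i + j + m)^2) * (qrec (q^2) i * qrec (q^2) j)
      * ((-1) powi l * q powi (2*l*l - 2*l) * qrec (q^2) (m - 2*l) * qrec (q^4) l)" for l
  proof -
    have "q powi (- 2*l) * q powi ((i + j + (m - 2*l) + 2*l)^2 + 2 * l^2) = q powi ((i + j + m)^2) * q powi (2*l*l - 2*l)"
      using nome_nonzero[OF q] by (simp add: powi_add power2_eq_square algebra_simps)
    then show ?thesis
      unfolding quad_term_def c prod.case by (simp add: mult_ac)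
  qed
  moreover have "b i j m * q powi ((i + j + m)^2 + m^2 - m) * (qrec (q^2) i * qrec (q^2) j * qrec (q^2) m) =
      b i j m * q powi ((i + j + m)^2) * (qrec (q^2) i * qrec (q^2) j) * (q powi (m*m - m) * qrec (q^2) m)"
  proof -
    have "q powi ((i + j + m)^2 + m^2 - m) = q powi ((i + j + m)^2) * q powi (m*m - m)"
      using nome_nonzero[OF q] by (simp add: powi_add power2_eq_square algebra_simps)
    then show ?thesis
      by (simp add: mult_ac)
  qed
  ultimately show "((\<lambda>l. quad_term q c ((\<lambda>((i, j, m), l). (i, j, m - 2*l, l)) (t, l))) has_sum
      (case t of (i, j, m) \<Rightarrow> b i j m * q powi ((i + j + m)^2 + m^2 - m) * (qrec (q^2) i * qrec (q^2) j * qrec (q^2) m))) UNIV"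
    using has_sum_cmult_right[OF has_sum_qrec_cancel[OF q, of m],
        of "b i j m * q powi ((i + j + m)^2) * (qrec (q^2) i * qrec (q^2) j)"]
    by (simp only: t prod.case)
qed (use summ in auto)

lemma has_sum_even_reindex:
  fixes f :: "int \<times> 'a \<Rightarrow> complex"
  assumes "\<And>n x. odd n \<Longrightarrow> f (n, x) = 0"
  shows "(f has_sum S) UNIV \<longleftrightarrow> ((\<lambda>(s, x). f (2 * s, x)) has_sum S) UNIV"
proof -
  define h :: "int \<times> 'a \<Rightarrow> int \<times> 'a" where "h = (\<lambda>(s, x). (2 * s, x))"
  have "inj h"
    by (auto simp: inj_def h_def)
  then have "((\<lambda>x. f (h x)) has_sum S) UNIV \<longleftrightarrow> (f has_sum S) (range h)"
    by (simp add: has_sum_reindex o_def)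
  also have "\<dots> \<longleftrightarrow> (f has_sum S) UNIV"
  proof (rule has_sum_cong_neutral)
    fix y assume y: "y \<in> UNIV - range h"
    obtain n x where nx: "y = (n, x)"
      by (cases y)
    have "odd n"
    proof
      assume "even n"
      then have "y = h (n div 2, x)"
        by (simp add: h_def nx)
      then show False
        using y by blast
    qed
    then show "f y = 0"
      using assms nx by simp
  qed auto
  finally show ?thesis
    by (simp add: h_def case_prod_unfold)
qed

text \<open>With $i$ and $j$ paired off, $(-vq^2y^2t^2;q^4)_\infty / (y^2t^2;q^4)_\infty$ is expanded by the
  $q$-binomial theorem.\<close>

lemma has_sum_reduce_ij:
  assumes q: "nome q"
    and c: "\<And>i j k l. c i j k l = (-1) powi i * y powi (i + j + 2*l) * z powi k * v powi l"
    and summ: "quad_term q c summable_on UNIV"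
  shows "(quad_term q c has_sum S) UNIV \<longleftrightarrow>
    ((\<lambda>r. y powi (2*r) * q powi (4*r*r) * qpoch (- v * q^2) (q^4) (nat r) * qrec (q^4) r *
        qpoch_inf (- z * q * q powi (4*r)) (q^2)) has_sum S) UNIV"
proof -
  note q0 = nome_nonzero[OF q]
  \<comment> \<open>\<open>d\<close> is the part of the term that is constant once n = i + j is
    fixed. \<open>F\<close> is the result of summing over i, \<open>G\<close> its restriction to
    even n = 2s, and \<open>H\<close> the result of summing over l.\<close>
  define d where "d n k l = y powi (n + 2*l) * z powi k * v powi l * q powi ((n + k + 2*l)^2 + 2 * l^2) *
      (qrec (q^2) k * qrec (q^4) l)" for n k l
  define F where "F = (\<lambda>(n, k, l). d n k l * (if even n then qrec (q^4) (n div 2) else 0))"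
  define G where "G = (\<lambda>(s, k, l). d (2 * s) k l * qrec (q^4) s)"
  define H where "H = (\<lambda>(r, k). y powi (2*r) * z powi k * q powi ((2*r + k)^2) * qrec (q^2) k *
      (qpoch (- v * q^2) (q^4) (nat r) * qrec (q^4) r))"
  have F: "(quad_term q c has_sum S) UNIV \<longleftrightarrow> (F has_sum S) UNIV" for S
  proof (rule has_sum_fibers[where h = "\<lambda>((n, k, l), i). (i, n - i, k, l)" and h' = "\<lambda>(i, j, k, l). ((i + j, k, l), i)"])
    fix t :: "int \<times> int \<times> int"
    obtain n k l where t: "t = (n, k, l)"
      by (cases t) auto
    have "quad_term q c (i, n - i, k, l) = d n k l * ((-1) powi i * qrec (q^2) i * qrec (q^2) (n - i))" for i
      by (simp add: quad_term_def c d_def mult_ac)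
    then show "((\<lambda>i. quad_term q c ((\<lambda>((n, k, l), i). (i, n - i, k, l)) (t, i))) has_sum F t) UNIV"
      using has_sum_cmult_right[OF has_sum_qrec_alternating[OF nome_power[OF q, of 2], of n], of "d n k l"]
      by (cases "even n") (simp_all add: t F_def flip: power_mult)
  qed (use summ in auto)
  have G: "(F has_sum S) UNIV \<longleftrightarrow> (G has_sum S) UNIV" for S
    by (subst has_sum_even_reindex) (auto simp: F_def G_def case_prod_unfold)
  have Gs: "G summable_on UNIV"
    using summ F G unfolding summable_on_def by blast
  \<comment> \<open>Grouping by r = s + l makes the large square (2r + k)^2 independent of l. What
    remains is 2l^2, that is, exponent l^2 in base q^2 as the q-binomial theorem requires.\<close>
  have H: "(G has_sum S) UNIV \<longleftrightarrow> (H has_sum S) UNIV" for S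
  proof (rule has_sum_fibers[where h = "\<lambda>((r, k), l). (r - l, k, l)" and h' = "\<lambda>(s, k, l). ((s + l, k), l)"])
    fix t :: "int \<times> int"
    obtain r k where t: "t = (r, k)"
      by (cases t) auto
    have "G (r - l, k, l) = y powi (2*r) * z powi k * q powi ((2*r + k)^2) * qrec (q^2) k *
       (v powi l * (q^2) powi (l*l) * qrec ((q^2)^2) (r - l) * qrec ((q^2)^2) l)" for l
    proof -
      have "q powi ((2*(r - l) + k + 2*l)^2 + 2 * l^2) = q powi ((2*r + k)^2) * (q^2) powi (l*l)"
        by (simp add: power_int_power powi_add q0 power2_eq_square[where 'a = int])
      then show ?thesis
        by (simp add: G_def d_def mult_ac flip: power_mult)
    qed
    then show "((\<lambda>l. G ((\<lambda>((r, k), l). (r - l, k, l)) (t, l))) has_sum H t) UNIV"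
      using has_sum_cmult_right[OF has_sum_q_binomial[OF nome_power[OF q, of 2], of v r],
          of "y powi (2*r) * z powi k * q powi ((2*r + k)^2) * qrec (q^2) k"]
      by (simp add: t H_def flip: power_mult)
  qed (use Gs in auto)
  have Hs: "H summable_on UNIV"
    using Gs H unfolding summable_on_def by blast
  \<comment> \<open>In (2r + k)^2 = 4r^2 + 4rk + k^2 the cross term is absorbed into the argument z
    q^(4r) of Euler's series in k.\<close>
  have "(H has_sum S) UNIV \<longleftrightarrow>
    ((\<lambda>r. y powi (2*r) * q powi (4*r*r) * qpoch (- v * q^2) (q^4) (nat r) * qrec (q^4) r *
        qpoch_inf (- z * q * q powi (4*r)) (q^2)) has_sum S) UNIV"
  proof (rule has_sum_fibers[where h = "\<lambda>(r, k). (r, k)" and h' = "\<lambda>(r, k). (r, k)"])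
    fix r
    have "H (r, k) = y powi (2*r) * q powi (4*r*r) * qpoch (- v * q^2) (q^4) (nat r) * qrec (q^4) r *
        ((z * q powi (4*r)) powi k * q powi (k*k) * qrec (q^2) k)" for k
    proof -
      have "q powi ((2*r + k)^2) = q powi (4*r*r) * (q powi (4*r)) powi k * q powi (k*k)"
        by (simp add: power_int_mult[symmetric] powi_add q0 power2_eq_square[where 'a = int] algebra_simps)
      then show ?thesis
        by (simp add: H_def power_int_mult_distrib mult_ac)
    qed
    then show "((\<lambda>k. H (case (r, k) of (r, k) \<Rightarrow> (r, k))) has_sum
       (y powi (2*r) * q powi (4*r*r) * qpoch (- v * q^2) (q^4) (nat r) * qrec (q^4) r *
        qpoch_inf (- z * q * q powi (4*r)) (q^2))) UNIV"
      using has_sum_cmult_right[OF has_sum_Euler[OF q, of "z * q powi (4*r)"],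
          of "y powi (2*r) * q powi (4*r*r) * qpoch (- v * q^2) (q^4) (nat r) * qrec (q^4) r"]
      by (simp add: mult_ac)
  qed (use Hs in auto)
  then show ?thesis
    using F G H by simp
qed

section \<open>Theta products\<close>

definition theta16_6 :: "complex \<Rightarrow> complex" where
  "theta16_6 q = qpochs_inf [q^6, q^10, q^16] (q^16)"

definition theta16_2 :: "complex \<Rightarrow> complex" where
  "theta16_2 q = qpochs_inf [q^2, q^14, q^16] (q^16)"

lemma range_even: "range (\<lambda>r. 2 * r) = {n::int. even n}"
  unfolding dvd_def by blast

lemma range_odd: "range (\<lambda>r. 2 * r + 1) = {n::int. odd n}"
  by (auto elim!: oddE)

text \<open>The triple product in base q^8 at z = -q^(-2); the companion for
  \<open>theta16_2\<close> takes z = -q^6.\<close>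

lemma has_sum_theta16_6:
  assumes q: "nome q"
  shows "((\<lambda>r. (-1) powi r * q powi (8*r*r - 2*r)) has_sum theta16_6 q) UNIV"
proof -
  note q0 = nome_nonzero[OF q]
  have "((\<lambda>k. (-(q powi (-2))) powi k * (q^8) powi (k*k)) has_sum
    (qpoch_inf (-(-(q powi (-2)))*q^8) ((q^8)^2) * qpoch_inf (-(q^8)/(-(q powi (-2)))) ((q^8)^2) * qpoch_inf ((q^8)^2) ((q^8)^2))) UNIV"
    by (rule Jacobi_triple_product) (use q0 nome_power[OF q] in auto)
  also have "(\<lambda>k. (-(q powi (-2))) powi k * (q^8) powi (k*k)) = (\<lambda>r. (-1) powi r * q powi (8*r*r - 2*r))"
    by (simp add: powi_quadratic_alternating[OF q0])
  also have "-(-(q powi (-2)))*q^8 = q^6"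
    using q0 by (simp_all add: power_int_minus field_simps flip: power_add)
  also have "-(q^8)/(-(q powi (-2))) = q^10"
    using q0 by (simp_all add: power_int_minus field_simps flip: power_add)
  finally show ?thesis
    by (simp add: theta16_6_def qpochs_inf_def mult_ac flip: power_mult)
qed

lemma has_sum_theta16_2:
  assumes q: "nome q"
  shows "((\<lambda>r. (-1) powi r * q powi (8*r*r + 6*r)) has_sum theta16_2 q) UNIV"
proof -
  note q0 = nome_nonzero[OF q]
  have "((\<lambda>k. (-(q^6)) powi k * (q^8) powi (k*k)) has_sum
    (qpoch_inf (-(-(q^6))*q^8) ((q^8)^2) * qpoch_inf (-(q^8)/(-(q^6))) ((q^8)^2) * qpoch_inf ((q^8)^2) ((q^8)^2))) UNIV"
    by (rule Jacobi_triple_product) (use q0 nome_power[OF q] in auto)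
  also have "(\<lambda>k. (-(q^6)) powi k * (q^8) powi (k*k)) = (\<lambda>r. (-1) powi r * q powi (8*r*r + 6*r))"
    using power_int_mult_distrib[of "-1" "q^6"]
    by (intro ext) (simp add: power_int_power powi_add q0 mult.assoc add.commute)
  also have "-(-(q^6))*q^8 = q^14"
    using q0 by (simp_all add: field_simps flip: power_add)
  also have "-(q^8)/(-(q^6)) = q^2"
    using q0 by (simp_all add: field_simps flip: power_add)
  finally show ?thesis
    by (simp add: theta16_2_def qpochs_inf_def mult_ac flip: power_mult)
qed

section \<open>Even and odd parts of Euler's series and of a theta series\<close>

lemma has_sum_parity_split:
  fixes f :: "int \<Rightarrow> complex"
  assumes f: "(f has_sum a) UNIV" "((\<lambda>n. (-1) powi n * f n) has_sum b) UNIV"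
  shows "((\<lambda>r. f (2*r)) has_sum (a + b) / 2) UNIV" "((\<lambda>r. f (2*r + 1)) has_sum (a - b) / 2) UNIV"
proof -
  have odd: "(-1::complex) powi (2*r + 1) = -1" for r
    by (simp add: power_int_add power_int_mult)
  have "((\<lambda>n. f n + (-1) powi n * f n) has_sum (a + b)) UNIV"
    by (rule has_sum_add[OF f])
  also have "?this \<longleftrightarrow> ((\<lambda>n. f n + (-1) powi n * f n) has_sum (a + b)) (range (\<lambda>r. 2*r))"
  proof (rule has_sum_cong_neutral)
    fix n :: int assume "n \<in> UNIV - range (\<lambda>r. 2*r)"
    then have "odd n"
      by (simp add: range_even)
    then show "f n + (-1) powi n * f n = 0"
      using odd by (auto elim!: oddE)
  qed auto
  also have "\<dots> \<longleftrightarrow> ((\<lambda>r. 2 * f (2*r)) has_sum (a + b)) UNIV"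
    by (subst has_sum_reindex) (auto simp: o_def inj_def power_int_mult)
  finally show "((\<lambda>r. f (2*r)) has_sum (a + b) / 2) UNIV"
    by (simp add: has_sum_cmult_right_iff)
  have "((\<lambda>n. f n + - ((-1) powi n * f n)) has_sum (a + - b)) UNIV"
    by (intro has_sum_add has_sum_uminusI f)
  also have "?this \<longleftrightarrow> ((\<lambda>n. f n + - ((-1) powi n * f n)) has_sum (a + - b)) (range (\<lambda>r. 2*r + 1))"
  proof (rule has_sum_cong_neutral)
    fix n :: int assume "n \<in> UNIV - range (\<lambda>r. 2*r + 1)"
    then have "even n"
      by (simp add: range_odd)
    then show "f n + - ((-1) powi n * f n) = 0"
      by (auto elim!: evenE simp: power_int_mult)
  qed auto
  also have "\<dots> \<longleftrightarrow> ((\<lambda>r. 2 * f (2*r + 1)) has_sum (a + - b)) UNIV"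
    by (subst has_sum_reindex) (auto simp: o_def inj_def odd)
  finally show "((\<lambda>r. f (2*r + 1)) has_sum (a - b) / 2) UNIV"
    by (simp add: has_sum_cmult_right_iff)
qed

lemma minus_powi_square: "(- s) powi (n * n) = (-1) powi n * (s::complex) powi (n * n)"
proof -
  have "(-1::complex) powi (n * n) = (-1) powi n"
    by (cases "even n") (auto elim!: evenE oddE simp: power_int_mult power_int_add)
  then show ?thesis
    using power_int_mult_distrib[of "-1" s "n * n"] by simp
qed

text \<open>As n^2 and n have the same parity, Euler's series at -s is the one at s with signs
  (-1)^n.\<close>

lemma has_sum_Euler_parity:
  assumes s: "nome s"
  defines "G \<equiv> qpoch_inf (- s) (s^2)" and "G' \<equiv> qpoch_inf s (s^2)"
  shows "((\<lambda>r. s powi ((2*r)*(2*r)) * qrec (s^2) (2*r)) has_sum (G + G') / 2) UNIV"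
    "((\<lambda>r. s powi ((2*r+1)*(2*r+1)) * qrec (s^2) (2*r+1)) has_sum (G - G') / 2) UNIV"
proof -
  have s': "nome (- s)"
    using s by (simp add: nome_def)
  have 1: "((\<lambda>n. s powi (n*n) * qrec (s^2) n) has_sum G) UNIV"
    using has_sum_Euler[OF s, of 1] by (simp add: G_def)
  have "((\<lambda>n. (-s) powi (n*n) * qrec (s^2) n) has_sum G') UNIV"
    using has_sum_Euler[OF s', of 1] by (simp add: G'_def)
  then have 2: "((\<lambda>n. (-1) powi n * (s powi (n*n) * qrec (s^2) n)) has_sum G') UNIV"
    by (simp add: minus_powi_square mult.assoc)
  show "((\<lambda>r. s powi ((2*r)*(2*r)) * qrec (s^2) (2*r)) has_sum (G + G') / 2) UNIV"
    "((\<lambda>r. s powi ((2*r+1)*(2*r+1)) * qrec (s^2) (2*r+1)) has_sum (G - G') / 2) UNIV"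
    using has_sum_parity_split[OF 1 2] by simp_all
qed

text \<open>The triple product in base s^2 at z = 1/s, with the triangular numbers k(2k - 1) as
  exponents. Its first two factors, in base s^4, merge into (-s;s^2)_inf, the same product as in
  Euler's series at z = 1.\<close>

lemma has_sum_triangular:
  assumes s: "nome s"
  shows "((\<lambda>k. s powi (2*k*k - k)) has_sum (qpoch_inf (- s) (s^2) * qpoch_inf (s^4) (s^4))) UNIV"
proof -
  note s0 = nome_nonzero[OF s]
  have "((\<lambda>k. (1/s) powi k * (s^2) powi (k*k)) has_sum
    (qpoch_inf (-(1/s) * s^2) ((s^2)^2) * qpoch_inf (-(s^2)/(1/s)) ((s^2)^2) * qpoch_inf ((s^2)^2) ((s^2)^2))) UNIV"
    by (rule Jacobi_triple_product) (use s0 nome_power[OF s] in auto)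
  also have "(\<lambda>k. (1/s) powi k * (s^2) powi (k*k)) = (\<lambda>k. s powi (2*k*k - k))"
    using s0 by (simp add: power_int_power power_int_one_over power_int_diff mult.assoc)
  also have "-(1/s) * s^2 = - s"
    using s0 by (simp_all add: power2_eq_square)
  also have "-(s^2)/(1/s) = (-s) * s^2"
    using s0 by (simp_all add: power2_eq_square)
  also have "qpoch_inf (- s) ((s^2)^2) * qpoch_inf ((-s) * s^2) ((s^2)^2) = qpoch_inf (- s) (s^2)"
    using qpoch_inf_parity[of "s^2" "-s"] nome_power[OF s, of 2] by (simp add: nome_def)
  finally show ?thesis
    by (simp flip: power_mult)
qed

text \<open>The even and odd parts (in $s = iq$) of Euler's series and of the triple product for the same
  infinite product are compared.\<close>

lemma has_sum_Slater:
  assumes q: "nome q"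
  defines "s \<equiv> \<i> * q"
  shows "((\<lambda>r. s powi ((2*r)*(2*r)) * qrec (s^2) (2*r)) has_sum theta16_6 q / qpoch_inf (q^4) (q^4)) UNIV"
    "((\<lambda>r. s powi ((2*r+1)*(2*r+1)) * qrec (s^2) (2*r+1)) has_sum s * theta16_2 q / qpoch_inf (q^4) (q^4)) UNIV"
proof -
  note q0 = nome_nonzero[OF q]
  have s: "nome s" "nome (- s)"
    using q by (simp_all add: nome_def s_def norm_mult)
  note s0 = nome_nonzero[OF s(1)]
  have s2: "s^2 = - (q^2)" and s4: "s^4 = q^4"
    by (simp_all add: s_def power_mult_distrib)
  define P where "P = qpoch_inf (q^4) (q^4)"
  have P: "P \<noteq> 0"
    unfolding P_def by (intro qpoch_inf_self_nonzero nome_power[OF q]) simp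
  define G where "G = qpoch_inf (- s) (s^2)"
  define G' where "G' = qpoch_inf s (s^2)"
  have 1: "((\<lambda>k. s powi (2*k*k - k)) has_sum (G * P)) UNIV"
    using has_sum_triangular[OF s(1)] by (simp add: G_def P_def s4)
  have "((\<lambda>k. (- s) powi (2*k*k - k)) has_sum (G' * P)) UNIV"
    using has_sum_triangular[OF s(2)] by (simp add: G'_def P_def s4)
  \<comment> \<open>The exponent 2k^2 - k has the parity of k, so the change from s to -s is again
    the sign (-1)^k.\<close>
  also have "(\<lambda>k. (- s) powi (2*k*k - k)) = (\<lambda>k. (-1) powi k * s powi (2*k*k - k))"
  proof
    fix k :: int
    have "(-1::complex) powi (2*k*k - k) = (-1) powi k"
      by (cases "even k") (auto elim!: evenE oddE simp: power_int_mult power_int_diff power_int_add mult.assoc)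
    then show "(- s) powi (2*k*k - k) = (-1) powi k * s powi (2*k*k - k)"
      using power_int_mult_distrib[of "-1" s "2*k*k - k"] by simp
  qed
  finally have 2: "((\<lambda>k. (-1) powi k * s powi (2*k*k - k)) has_sum (G' * P)) UNIV" .
  have "((\<lambda>r. s powi (2*(2*r)*(2*r) - 2*r)) has_sum (G * P + G' * P) / 2) UNIV"
    by (rule has_sum_parity_split(1)[OF 1 2])
  also have "(\<lambda>r. s powi (2*(2*r)*(2*r) - 2*r)) = (\<lambda>r. (-1) powi r * q powi (8*r*r - 2*r))"
  proof
    fix r :: int
    have "s powi (2*(2*r)*(2*r) - 2*r) = s powi (2 * (4*r*r - r))"
      by (rule powi_cong) (simp add: algebra_simps)
    also have "\<dots> = (-1 * q^2) powi (4*r*r - r)"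
      unfolding power_int_mult by (simp add: s2)
    also have "\<dots> = (-1) powi (4*r*r - r) * q powi (8*r*r - 2*r)"
      by (simp only: power_int_mult_distrib power_int_power) (simp add: algebra_simps)
    also have "(-1::complex) powi (4*r*r - r) = (-1) powi r"
      by (cases "even r") (auto elim!: evenE oddE simp: power_int_mult power_int_diff power_int_add mult.assoc)
    finally show "s powi (2*(2*r)*(2*r) - 2*r) = (-1) powi r * q powi (8*r*r - 2*r)" .
  qed
  finally have "(G * P + G' * P) / 2 = theta16_6 q"
    using has_sum_theta16_6[OF q] has_sum_unique by blast
  then have E: "(G + G') / 2 = theta16_6 q / P"
    using P by (simp add: field_simps)
  \<comment> \<open>At k = 2r + 1 the exponent is 8r^2 + 6r + 1; its last 1 is the factor s in front
    of \<open>theta16_2\<close>.\<close>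
  have "((\<lambda>r. s powi (2*(2*r+1)*(2*r+1) - (2*r+1))) has_sum (G * P - G' * P) / 2) UNIV"
    by (rule has_sum_parity_split(2)[OF 1 2])
  also have "(\<lambda>r. s powi (2*(2*r+1)*(2*r+1) - (2*r+1))) = (\<lambda>r. s * ((-1) powi r * q powi (8*r*r + 6*r)))"
  proof
    fix r :: int
    have "s powi (2*(2*r+1)*(2*r+1) - (2*r+1)) = s powi (1 + 2 * (4*r*r + 3*r))"
      by (rule powi_cong) (simp add: algebra_simps)
    also have "\<dots> = s * (-1 * q^2) powi (4*r*r + 3*r)"
      by (simp only: powi_add[OF s0, symmetric] power_int_mult) (simp add: s2)
    also have "\<dots> = s * ((-1) powi (4*r*r + 3*r) * q powi (8*r*r + 6*r))"
      by (simp only: power_int_mult_distrib power_int_power) (simp add: algebra_simps)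
    also have "(-1::complex) powi (4*r*r + 3*r) = (-1) powi r"
      by (cases "even r") (auto elim!: evenE oddE simp: power_int_mult power_int_diff power_int_add mult.assoc)
    finally show "s powi (2*(2*r+1)*(2*r+1) - (2*r+1)) = s * ((-1) powi r * q powi (8*r*r + 6*r))" .
  qed
  finally have "(G * P - G' * P) / 2 = s * theta16_2 q"
    using has_sum_cmult_right[OF has_sum_theta16_2[OF q]] has_sum_unique by blast
  then have O: "(G - G') / 2 = s * theta16_2 q / P"
    using P by (simp add: field_simps)
  show "((\<lambda>r. s powi ((2*r)*(2*r)) * qrec (s^2) (2*r)) has_sum theta16_6 q / qpoch_inf (q^4) (q^4)) UNIV"
    "((\<lambda>r. s powi ((2*r+1)*(2*r+1)) * qrec (s^2) (2*r+1)) has_sum s * theta16_2 q / qpoch_inf (q^4) (q^4)) UNIV"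
    using has_sum_Euler_parity[OF s(1)] E O unfolding G_def G'_def P_def by simp_all
qed

text \<open>The double series of the left-hand side is split by the parity of $m + n$.\<close>

lemma theta_product:
  assumes q: "nome q"
  shows "qpochs_inf [-q, -(q^7), q^8] (q^8) * qpochs_inf [q^3, q^5, q^8] (q^8) =
    qpochs_inf [q^4, q^12, q^16] (q^16) * (theta16_6 q + q * theta16_2 q)"
proof -
  note q0 = nome_nonzero[OF q]
  \<comment> \<open>Theta series of the three-factor products: base q^4 at z = q^(-3) and z =
    -q^(-1) for \<open>A\<close> and \<open>B\<close>, base q^8 at z = -q^(-4) for
    \<open>C\<close>.\<close>
  define A where "A m = q powi (4*m*m - 3*m)" for m
  define B where "B n = (-1) powi n * q powi (4*n*n - n)" for n
  define C where "C u = (-1) powi u * q powi (8*u*u - 4*u)" for u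
  define X where "X v = (-1) powi v * q powi (8 * v * v - 2 * v)" for v
  define Y where "Y v = (-1) powi v * q powi (8 * v * v + 6 * v)" for v
  have A: "(A has_sum qpochs_inf [-q, -(q^7), q^8] (q^8)) UNIV"
  proof -
    have "((\<lambda>k. (q powi (-3)) powi k * (q^4) powi (k*k)) has_sum
      (qpoch_inf (-(q powi (-3))*q^4) ((q^4)^2) * qpoch_inf (-(q^4)/(q powi (-3))) ((q^4)^2) * qpoch_inf ((q^4)^2) ((q^4)^2))) UNIV"
      by (rule Jacobi_triple_product) (use q0 nome_power[OF q] in auto)
    also have "(\<lambda>k. (q powi (-3)) powi k * (q^4) powi (k*k)) = A"
      by (intro ext) (simp add: A_def powi_quadratic[OF q0])
    also have "-(q powi (-3))*q^4 = -q"
      using q0 by (simp_all add: power_int_minus field_simps eval_nat_numeral)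
    also have "-(q^4)/(q powi (-3)) = -(q^7)"
      using q0 by (simp_all add: power_int_minus field_simps eval_nat_numeral)
    finally show ?thesis
      by (simp add: qpochs_inf_def mult_ac flip: power_mult)
  qed
  have B: "(B has_sum qpochs_inf [q^3, q^5, q^8] (q^8)) UNIV"
  proof -
    have "((\<lambda>k. (-(q powi (-1))) powi k * (q^4) powi (k*k)) has_sum
      (qpoch_inf (-(-(q powi (-1)))*q^4) ((q^4)^2) * qpoch_inf (-(q^4)/(-(q powi (-1)))) ((q^4)^2) * qpoch_inf ((q^4)^2) ((q^4)^2))) UNIV"
      by (rule Jacobi_triple_product) (use q0 nome_power[OF q] in auto)
    also have "(\<lambda>k. (-(q powi (-1))) powi k * (q^4) powi (k*k)) = B"
      by (intro ext) (simp add: B_def powi_quadratic_alternating[OF q0] del: power_int_minus1_right)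
    also have "-(-(q powi (-1)))*q^4 = q^3"
      using q0 by (simp_all add: field_simps eval_nat_numeral)
    also have "-(q^4)/(-(q powi (-1))) = q^5"
      using q0 by (simp_all add: field_simps eval_nat_numeral)
    finally show ?thesis
      by (simp add: qpochs_inf_def mult_ac flip: power_mult)
  qed
  have C: "(C has_sum qpochs_inf [q^4, q^12, q^16] (q^16)) UNIV"
  proof -
    have "((\<lambda>k. (-(q powi (-4))) powi k * (q^8) powi (k*k)) has_sum
      (qpoch_inf (-(-(q powi (-4)))*q^8) ((q^8)^2) * qpoch_inf (-(q^8)/(-(q powi (-4)))) ((q^8)^2) * qpoch_inf ((q^8)^2) ((q^8)^2))) UNIV"
      by (rule Jacobi_triple_product) (use q0 nome_power[OF q] in auto)
    also have "(\<lambda>k. (-(q powi (-4))) powi k * (q^8) powi (k*k)) = C"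
      by (intro ext) (simp add: C_def powi_quadratic_alternating[OF q0])
    also have "-(-(q powi (-4)))*q^8 = q^4"
      using q0 by (simp_all add: power_int_minus field_simps flip: power_add)
    also have "-(q^8)/(-(q powi (-4))) = q^12"
      using q0 by (simp_all add: power_int_minus field_simps flip: power_add)
    finally show ?thesis
      by (simp add: qpochs_inf_def mult_ac flip: power_mult)
  qed
  have X: "(X has_sum theta16_6 q) UNIV" and Y: "(Y has_sum theta16_2 q) UNIV"
    unfolding X_def Y_def by (rule has_sum_theta16_6[OF q] has_sum_theta16_2[OF q])+
  define F where "F = (\<lambda>(m, n). A m * B n)"
  define E where "E = {(m::int, n::int). even (m + n)}"
  \<comment> \<open>For even m + n, the substitution m = u + v, n = u - v turns the exponent into
    (8u^2 - 4u) + (8v^2 - 2v).\<close>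
  have "((\<lambda>(u, v). C u * X v) has_sum (qpochs_inf [q^4, q^12, q^16] (q^16) * theta16_6 q)) UNIV"
    by (rule has_sum_times[OF C X])
  also have "?this \<longleftrightarrow> (F has_sum (qpochs_inf [q^4, q^12, q^16] (q^16) * theta16_6 q)) E"
  proof (rule has_sum_reindex_bij_witness[of _ "\<lambda>(m, n). ((m + n) div 2, (m - n) div 2)" "\<lambda>(u, v). (u + v, u - v)"])
    fix t :: "int \<times> int"
    obtain u v where t: "t = (u, v)"
      by (cases t)
    have "q powi (4*(u+v)*(u+v) - 3*(u+v)) * q powi (4*(u-v)*(u-v) - (u-v)) = q powi (8*u*u - 4*u) * q powi (8 * v * v - 2 * v)"
      by (simp add: powi_add q0 algebra_simps)
    moreover have "(-1::complex) powi (u - v) = (-1) powi u * (-1) powi v"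
      using neg_one_powi_shift[of "u - v" v] powi_add[of "-1" u v] by (simp add: algebra_simps)
    ultimately have "A (u + v) * B (u - v) = C u * X v"
      unfolding A_def B_def C_def X_def by algebra
    then show "F ((\<lambda>(u, v). (u + v, u - v)) t) = (\<lambda>(u, v). C u * X v) t"
      by (simp add: F_def t)
  qed (auto simp: E_def, presburger+)
  finally have 1: "(F has_sum (qpochs_inf [q^4, q^12, q^16] (q^16) * theta16_6 q)) E" .
  \<comment> \<open>For odd m + n, the choice m = 1 - u + v, n = -u - v gives 1 + (8u^2 - 4u) +
    (8v^2 + 6v): the offset is such that the series in u is \<open>C\<close> again, and the 1 is the
    factor q.\<close>
  have "((\<lambda>t. q * (\<lambda>(u, v). C u * Y v) t) has_sum (q * (qpochs_inf [q^4, q^12, q^16] (q^16) * theta16_2 q))) UNIV"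
    by (rule has_sum_cmult_right[OF has_sum_times[OF C Y]])
  also have "?this \<longleftrightarrow> (F has_sum (q * (qpochs_inf [q^4, q^12, q^16] (q^16) * theta16_2 q))) (- E)"
  proof (rule has_sum_reindex_bij_witness[of _ "\<lambda>(m, n). ((1 - m - n) div 2, (m - n - 1) div 2)" "\<lambda>(u, v). (1 - u + v, - u - v)"])
    fix t :: "int \<times> int"
    obtain u v where t: "t = (u, v)"
      by (cases t)
    have "q powi (4*(1-u+v)*(1-u+v) - 3*(1-u+v)) * q powi (4*(-u-v)*(-u-v) - (-u-v)) = q powi 1 * (q powi (8*u*u - 4*u) * q powi (8 * v * v + 6 * v))"
      by (simp only: powi_add[OF q0]) (rule powi_cong, simp add: algebra_simps)
    moreover have "(-1::complex) powi (- u - v) = (-1) powi u * (-1) powi v"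
      using neg_one_powi_shift[of "- u - v" "u + v"] powi_add[of "-1" u v] by (simp add: algebra_simps)
    ultimately have "A (1 - u + v) * B (- u - v) = q * (C u * Y v)"
      unfolding A_def B_def C_def Y_def power_int_1_right by algebra
    then show "F ((\<lambda>(u, v). (1 - u + v, - u - v)) t) = q * (\<lambda>(u, v). C u * Y v) t"
      by (simp add: F_def t)
  qed (auto simp: E_def, presburger+)
  finally have 2: "(F has_sum (q * (qpochs_inf [q^4, q^12, q^16] (q^16) * theta16_2 q))) (- E)" .
  have "(F has_sum (qpochs_inf [-q, -(q^7), q^8] (q^8) * qpochs_inf [q^3, q^5, q^8] (q^8))) UNIV"
    unfolding F_def by (rule has_sum_times[OF A B])
  then show ?thesis
    using has_sum_Un_disjoint[OF 1 2] has_sum_unique by (fastforce simp: algebra_simps)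
qed

text \<open>Every product is broken up into the nonzero h n = (q^n;q^16)_inf; the claims are then
  cancellations in \<open>theta_product\<close>.\<close>

lemma theta16_factors:
  assumes q: "nome q"
  defines "h \<equiv> (\<lambda>n::nat. qpoch_inf (q^n) (q^16))"
  shows "(theta16_6 q + q * theta16_2 q) / qpoch_inf (q^2) (q^2) =
      (h 3 * h 5 * h 8 * h 11 * h 13) / (h 1 * h 4 * h 4 * h 6 * h 7 * h 9 * h 10 * h 12 * h 12 * h 15)" (is ?plus)
    and "(theta16_6 q - q * theta16_2 q) / qpoch_inf (q^2) (q^2) =
      (h 1 * h 7 * h 8 * h 9 * h 15) / (h 2 * h 3 * h 4 * h 4 * h 5 * h 11 * h 12 * h 12 * h 13 * h 14)" (is ?minus)
proof -
  have n: "norm (q^n) < 1" if "n > 0" for n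
    using nome_norm[OF nome_power[OF q that]] .
  have h0: "h n \<noteq> 0" if "n > 0" for n
    unfolding h_def by (intro qpoch_inf_nonzero n) (use that in auto)
  have split8: "qpoch_inf (q^a) (q^8) = h a * h (a + 8)" for a
    using qpoch_inf_parity[OF n, of 8 "q^a"] by (simp add: h_def flip: power_mult power_add)
  have split4: "qpoch_inf (q^a) (q^4) = h a * h (a + 8) * (h (a + 4) * h (12 + a))" for a
    using qpoch_inf_parity[OF n, of 4 "q^a"] by (simp add: split8 flip: power_mult power_add)
  have split2: "qpoch_inf (q^2) (q^2) = h 2 * h 10 * (h 6 * h 14) * (h 4 * h 12 * (h 8 * h 16))"
    using qpoch_inf_parity[OF n, of 2 "q^2"] by (simp add: split4 flip: power_mult power_add)
  have neg8: "qpoch_inf (-(q^a)) (q^8) = h (2*a) / (h a * h (a + 8))" if "a > 0" for a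
  proof -
    have "h (2*a) = qpoch_inf (q^a) (q^8) * qpoch_inf (-(q^a)) (q^8)"
      using qpoch_inf_square[OF n, of 8 "q^a"] by (simp add: h_def mult.commute flip: power_mult)
    then show ?thesis
      using h0[of a] h0[of "a + 8"] that by (simp add: split8)
  qed
  note h_nz = h0[of 1] h0[of 2] h0[of 3] h0[of 4] h0[of 5] h0[of 6] h0[of 7] h0[of 8] h0[of 9] h0[of 10]
    h0[of 11] h0[of 12] h0[of 13] h0[of 14] h0[of 15] h0[of 16]
  have nz: "h 4 * h 12 * h 16 \<noteq> 0"
    using h_nz by simp
  have "h 2 / (h 1 * h 9) * (h 14 / (h 7 * h 15)) * (h 8 * h 16) * (h 3 * h 11 * (h 5 * h 13) * (h 8 * h 16)) =
      h 4 * h 12 * h 16 * (theta16_6 q + q * theta16_2 q)"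
    using theta_product[OF q] neg8[of 1] neg8[of 7] split8[of 3] split8[of 5] split8[of 8]
    by (simp add: qpochs_inf_def h_def[symmetric] mult.assoc) (simp add: h_def mult_ac)
  then have plus: "theta16_6 q + q * theta16_2 q =
      h 2 / (h 1 * h 9) * (h 14 / (h 7 * h 15)) * (h 8 * h 16) * (h 3 * h 11 * (h 5 * h 13) * (h 8 * h 16)) / (h 4 * h 12 * h 16)"
    using nz by (metis nonzero_mult_div_cancel_left)
  show ?plus
    unfolding plus split2 using h_nz by (simp add: field_simps)
  \<comment> \<open>The difference comes from \<open>theta_product\<close> at -q: both theta
    functions contain only even powers of q, so only the sign of the factor q changes.\<close>
  have q': "nome (- q)"
    using q by (simp add: nome_def)
  have "theta16_6 (- q) = theta16_6 q" "theta16_2 (- q) = theta16_2 q"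
    by (simp_all add: theta16_6_def theta16_2_def)
  then have "h 1 * h 9 * (h 7 * h 15) * (h 8 * h 16) * (h 6 / (h 3 * h 11) * (h 10 / (h 5 * h 13)) * (h 8 * h 16)) =
      h 4 * h 12 * h 16 * (theta16_6 q - q * theta16_2 q)"
    using theta_product[OF q'] neg8[of 3] neg8[of 5] split8[of 1] split8[of 7] split8[of 8]
    by (simp add: qpochs_inf_def h_def[symmetric] mult.assoc) (simp add: h_def mult_ac)
  then have minus: "theta16_6 q - q * theta16_2 q =
      h 1 * h 9 * (h 7 * h 15) * (h 8 * h 16) * (h 6 / (h 3 * h 11) * (h 10 / (h 5 * h 13)) * (h 8 * h 16)) / (h 4 * h 12 * h 16)"
    using nz by (metis nonzero_mult_div_cancel_left)
  show ?minus
    unfolding minus split2 using h_nz by (simp add: field_simps)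
qed

text \<open>The left side is the term produced by \<open>has_sum_reduce_ij\<close> at y = 1, z = q,
  v = q^2. Moving the tail to (-q^2;q^2)_inf cancels (-q^4;q^4)_r and leaves the denominator
  (-q^2;q^4)_r (q^4;q^4)_r = (s^2;s^2)_(2r).\<close>

lemma Slater_even_term:
  assumes q: "nome q"
  defines "s \<equiv> \<i> * q"
  shows "q powi (4*r*r) * qpoch (-(q^4)) (q^4) (nat r) * qrec (q^4) r * qpoch_inf (-(q^2 * q powi (4*r))) (q^2) =
    qpoch_inf (-(q^2)) (q^2) * (s powi ((2*r)*(2*r)) * qrec (s^2) (2*r))"
proof (cases "r < 0")
  case False
  define n where "n = nat r"
  have r: "r = int n"
    using False by (simp add: n_def)
  have s2: "s^2 = - (q^2)" and s4: "s^4 = q^4"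
    by (simp_all add: s_def power_mult_distrib)
  have 1: "qpoch_inf (-(q^2)) (q^2) = qpoch (-(q^2)) (q^4) n * qpoch (-(q^4)) (q^4) n * qpoch_inf (-(q^2 * q powi (4*r))) (q^2)"
    using qpoch_inf_neg_square_shift[OF q, of n] power_int_of_nat[of q "4*n"] by (simp add: r)
  have 2: "s powi ((2*r)*(2*r)) = q powi (4*r*r)"
    using power_int_power[of s 4 "r*r"] power_int_power[of q 4 "r*r"] s4 by (simp add: mult_ac)
  have "qpoch (s^2) (s^2) (2*n) = qpoch (s^2) (s^4) n * qpoch (s^4) (s^4) n"
    by (simp add: qpoch_double flip: power_mult power_add)
  then have 3: "qrec (s^2) (2*r) = 1 / (qpoch (-(q^2)) (q^4) n * qpoch (q^4) (q^4) n)"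
    using qrec_of_nat[of "s^2" "2*n"] unfolding s2 s4 r by simp
  have 4: "qrec (q^4) r = 1 / qpoch (q^4) (q^4) n" "nat r = n"
    by (simp_all add: r qrec_of_nat)
  have "qpoch (-(q^2)) (q^4) n \<noteq> 0" "qpoch (q^4) (q^4) n \<noteq> 0"
    using nome_norm[OF nome_power[OF q, of 2]] nome_norm[OF nome_power[OF q, of 4]]
    by (intro qpoch_nonzero; simp)+
  then show ?thesis
    unfolding 1 2 3 4 by (simp add: field_simps)
qed simp

text \<open>Here y = q^2, z = q^3, v = q^2. The tail starts one factor later than in the even case,
  and the missing 1 + q^(4r+2) is the last factor of (s^2;s^2)_(2r+1). The prefactor s completes
  s^((2r+1)^2).\<close>

lemma Slater_odd_term:
  assumes q: "nome q"
  defines "s \<equiv> \<i> * q"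
  shows "s * (q powi (4*r*r + 4*r) * qpoch (-(q^4)) (q^4) (nat r) * qrec (q^4) r * qpoch_inf (-(q^4 * q powi (4*r))) (q^2)) =
    qpoch_inf (-(q^2)) (q^2) * (s powi ((2*r+1)*(2*r+1)) * qrec (s^2) (2*r+1))"
proof (cases "r < 0")
  case False
  define n where "n = nat r"
  have r: "r = int n"
    using False by (simp add: n_def)
  have s0: "s \<noteq> 0"
    using nome_nonzero[OF q] by (simp add: s_def)
  have s2: "s^2 = - (q^2)" and s4: "s^4 = q^4"
    by (simp_all add: s_def power_mult_distrib)
  have "qpoch_inf (-(q^2 * q powi (4*r))) (q^2) =
      (1 + q^2 * q powi (4*r)) * qpoch_inf (-(q^4 * q powi (4*r))) (q^2)"
    using qpoch_inf_shift[OF nome_norm[OF nome_power[OF q, of 2]], of "-(q^2 * q powi (4*r))" 1]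
    by (simp add: qpoch_def mult_ac flip: power_add)
  then have 1: "qpoch_inf (-(q^2)) (q^2) = qpoch (-(q^2)) (q^4) n * qpoch (-(q^4)) (q^4) n *
      ((1 + q^2 * q powi (4*r)) * qpoch_inf (-(q^4 * q powi (4*r))) (q^2))"
    using qpoch_inf_neg_square_shift[OF q, of n] power_int_of_nat[of q "4*n"] by (simp add: r)
  have 2: "s powi ((2*r+1)*(2*r+1)) = s * q powi (4*r*r + 4*r)"
  proof -
    have "s powi ((2*r+1)*(2*r+1)) = s powi 1 * s powi (4 * (r*r + r))"
      unfolding powi_add[OF s0] by (rule powi_cong) (simp add: algebra_simps)
    also have "\<dots> = s * (q^4) powi (r*r + r)"
      unfolding power_int_mult[of s 4] by (simp add: s4)
    also have "(q^4) powi (r*r + r) = q powi (4*r*r + 4*r)"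
      unfolding power_int_power by (rule powi_cong) (simp add: algebra_simps)
    finally show ?thesis .
  qed
  have "qpoch (s^2) (s^2) (2*n) = qpoch (s^2) (s^4) n * qpoch (s^4) (s^4) n"
    by (simp add: qpoch_double flip: power_mult power_add)
  moreover have "(s^2)^(2*n) = q powi (4*r)"
    using s4 power_int_of_nat[of q "4*n"] by (simp add: r power_mult flip: power_mult[of s 2 2])
  ultimately have "qpoch (s^2) (s^2) (2*n+1) = qpoch (-(q^2)) (q^4) n * qpoch (q^4) (q^4) n * (1 + q^2 * q powi (4*r))"
    by (simp add: qpoch_Suc s2 s4)
  then have 3: "qrec (s^2) (2*r+1) = 1 / (qpoch (-(q^2)) (q^4) n * qpoch (q^4) (q^4) n * (1 + q^2 * q powi (4*r)))"
    using qrec_of_nat[of "s^2" "2*n+1"] by (simp add: r add.commute)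
  have 4: "qrec (q^4) r = 1 / qpoch (q^4) (q^4) n" "nat r = n"
    by (simp_all add: r qrec_of_nat)
  define w where "w = 1 + q^2 * q powi (4*r)"
  have "qpoch (-(q^2)) (q^4) n \<noteq> 0" "qpoch (q^4) (q^4) n \<noteq> 0"
    using nome_norm[OF nome_power[OF q, of 2]] nome_norm[OF nome_power[OF q, of 4]]
    by (intro qpoch_nonzero; simp)+
  moreover have "1 + q^2 * q powi (4*r) \<noteq> 0"
    using qpoch_self_nonzero[of "s^2" "2*n+1"] \<open>qpoch (s^2) (s^2) (2*n+1) = _\<close> q
    by (auto simp: nome_def s_def norm_mult norm_power power_less_one_iff)
  ultimately show ?thesis
    unfolding 1 2 3 4 w_def[symmetric] by (simp add: field_simps)
qed simp

section \<open>The nine identities\<close>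

text \<open>With M = i + m and N = j + m, (i+j+m)^2 + m^2 = M^2 + N^2 + 2(M-m)(N-m). The sum over m
  is q-Vandermonde in base q^2, and two independent Euler series remain. Exponents such as i + k +
  2l are kept whole, because a or b may be 0.\<close>

lemma quad_identity_1:
  assumes q: "nome q"
  shows "(quad_term q (\<lambda>i j k l. (-1) powi (i + j + l) * q powi k * a powi (i + k + 2*l) * b powi (j + k + 2*l))
    has_sum (qpoch_inf (a * q) (q^2) * qpoch_inf (b * q) (q^2))) UNIV"
proof -
  note q0 = nome_nonzero[OF q]
  define c where "c i j k l = (-1) powi (i + j + l) * q powi k * a powi (i + k + 2*l) * b powi (j + k + 2*l)" for i j k l :: int
  define F where "F = (\<lambda>(i, j, m). ((-1) powi (i + j) * a powi (i + m) * b powi (j + m) * q powi m) *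
     q powi ((i + j + m)^2 + m^2 - m) * (qrec (q^2) i * qrec (q^2) j * qrec (q^2) m))"
  define G where "G = (\<lambda>(M::int, N::int). ((-a) powi M * q powi (M*M) * qrec (q^2) M) * ((-b) powi N * q powi (N*N) * qrec (q^2) N))"
  have cs: "quad_term q c summable_on UNIV"
  proof (rule summable_quad_term[OF q])
    show "c (int i) (int j) (int k) (int l) = (-a) ^ i * (-b) ^ j * (q*a*b) ^ k * (-(a^2*b^2)) ^ l" for i j k l
    proof -
      have "c (int i) (int j) (int k) (int l) = (-1) ^ (i + j + l) * q ^ k * a ^ (i + k + 2*l) * b ^ (j + k + 2*l)"
        unfolding c_def by (simp only: power_int_of_nat flip: of_nat_add of_nat_mult of_nat_numeral[where 'a = int])
      then show ?thesis
        by (simp add: power_add power_mult power_mult_distrib power_minus[of a] power_minus[of b] power_minus[of "a^2*b^2"])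
    qed
  qed
  have F: "(quad_term q c has_sum S) UNIV \<longleftrightarrow> (F has_sum S) UNIV" for S
    unfolding F_def
  proof (rule has_sum_reduce_kl[OF q _ cs])
    show "c i j k l = (-1) powi (i + j) * a powi (i + (k + 2*l)) * b powi (j + (k + 2*l)) * q powi (k + 2*l) *
        ((-1) powi l * q powi (- 2*l))" for i j k l
    proof -
      have e: "q powi k = q powi (k + 2*l) * q powi (- 2*l)" "(-1::complex) powi (i + j + l) = (-1) powi (i + j) * (-1) powi l"
        by (simp_all add: powi_add q0)
      show ?thesis
        unfolding c_def e by (simp add: add.assoc mult_ac)
    qed
  qed
  have Fs: "F summable_on UNIV"
    using cs F unfolding summable_on_def by blast
  have "(F has_sum S) UNIV \<longleftrightarrow> (G has_sum S) UNIV" for S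
  proof (rule has_sum_fibers[where h = "\<lambda>((M, N), m). (M - m, N - m, m)" and h' = "\<lambda>(i, j, m). ((i + m, j + m), m)"])
    fix t :: "int \<times> int"
    obtain M N where t: "t = (M, N)"
      by (cases t) auto
    have "F (M - m, N - m, m) = ((-a) powi M * q powi (M*M)) * ((-b) powi N * q powi (N*N)) *
       ((q^2) powi ((M - m) * (N - m)) * qrec (q^2) (M - m) * qrec (q^2) (N - m) * qrec (q^2) m)" for m
    proof -
      have "q powi m * q powi ((M - m + (N - m) + m)^2 + m^2 - m) = q powi (M*M) * q powi (N*N) * (q^2) powi ((M - m) * (N - m))"
        by (simp add: power_int_power powi_add q0 power2_eq_square[where 'a = int] algebra_simps)
      moreover have "(-1::complex) powi (M - m + (N - m)) = (-1) powi M * (-1) powi N"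
        using powi_add[of "-1" "M + N" "2 * (- m)"] powi_add[of "-1" M N]
        by (simp add: power_int_mult algebra_simps)
      moreover have "(-a) powi M = (-1) powi M * a powi M" "(-b) powi N = (-1) powi N * b powi N"
        using power_int_mult_distrib[of "-1" a M] power_int_mult_distrib[of "-1" b N] by simp_all
      ultimately show ?thesis
        unfolding F_def prod.case diff_add_cancel by algebra
    qed
    then show "((\<lambda>m. F ((\<lambda>((M, N), m). (M - m, N - m, m)) (t, m))) has_sum G t) UNIV"
      using has_sum_cmult_right[OF has_sum_q_Vandermonde[OF nome_power[OF q, of 2], of M N],
          of "((-a) powi M * q powi (M*M)) * ((-b) powi N * q powi (N*N))"]
      by (simp add: t G_def mult_ac)
  qed (use Fs in auto)
  moreover have "(G has_sum (qpoch_inf (-(-a) * q) (q^2) * qpoch_inf (-(-b) * q) (q^2))) UNIV"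
    unfolding G_def by (intro has_sum_times has_sum_Euler[OF q])
  ultimately show ?thesis
    using F by (simp add: c_def[abs_def])
qed

text \<open>At v = 1 the reduced term carries (-q^2;q^4)_r, which cancels against the shifted tail.
  The denominator becomes (q^4;q^4)_r (-q^4;q^4)_r = (q^8;q^8)_r, so Euler's series in base q^4 at
  a^2 remains.\<close>

lemma quad_identity_9:
  assumes q: "nome q"
  shows "(quad_term q (\<lambda>i j k l. (-1) powi i * q powi k * a powi (i + j + 2*l))
    has_sum (qpoch_inf (-(q^2)) (q^2) * qpoch_inf (-(a^2*q^4)) (q^8))) UNIV"
proof -
  note q0 = nome_nonzero[OF q]
  define c where "c i j k l = (-1) powi i * q powi k * a powi (i + j + 2*l)" for i j k l :: int
  have cs: "quad_term q c summable_on UNIV"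
  proof (rule summable_quad_term[OF q])
    show "c (int i) (int j) (int k) (int l) = (-a) ^ i * a ^ j * q ^ k * (a^2) ^ l" for i j k l
    proof -
      have "c (int i) (int j) (int k) (int l) = (-1) ^ i * q ^ k * a ^ (i + j + 2*l)"
        unfolding c_def by (simp only: power_int_of_nat flip: of_nat_add of_nat_mult of_nat_numeral[where 'a = int])
      then show ?thesis
        by (simp add: power_add power_mult power_mult_distrib power_minus[of a])
    qed
  qed
  have "((\<lambda>r. qpoch_inf (-(q^2)) (q^2) * ((a^2) powi r * (q^4) powi (r*r) * qrec ((q^4)^2) r)) has_sum
      (qpoch_inf (-(q^2)) (q^2) * qpoch_inf (-(a^2) * q^4) ((q^4)^2))) UNIV"
    using nome_power[OF q, of 4] by (intro has_sum_cmult_right has_sum_Euler) auto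
  also have "(\<lambda>r. qpoch_inf (-(q^2)) (q^2) * ((a^2) powi r * (q^4) powi (r*r) * qrec ((q^4)^2) r)) =
    (\<lambda>r. a powi (2*r) * q powi (4*r*r) * qpoch (- 1 * q^2) (q^4) (nat r) * qrec (q^4) r *
        qpoch_inf (- q * q * q powi (4*r)) (q^2))"
  proof
    fix r
    show "qpoch_inf (-(q^2)) (q^2) * ((a^2) powi r * (q^4) powi (r*r) * qrec ((q^4)^2) r) =
      a powi (2*r) * q powi (4*r*r) * qpoch (- 1 * q^2) (q^4) (nat r) * qrec (q^4) r * qpoch_inf (- q * q * q powi (4*r)) (q^2)"
    proof (cases "r < 0")
      case False
      define n where "n = nat r"
      have r: "r = int n"
        using False by (simp add: n_def)
      have 1: "qpoch_inf (-(q^2)) (q^2) = qpoch (-(q^2)) (q^4) n * qpoch (-(q^4)) (q^4) n *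
          qpoch_inf (- q * q * q powi (4*r)) (q^2)"
        using qpoch_inf_neg_square_shift[OF q, of n] power_int_of_nat[of q "4*n"] by (simp add: r power2_eq_square)
      have 2: "qpoch ((q^4)^2) ((q^4)^2) n = qpoch (q^4) (q^4) n * qpoch (-(q^4)) (q^4) n"
        by (rule qpoch_square)
      have "qpoch ((q^4)^2) ((q^4)^2) n \<noteq> 0"
        using nome_power[OF q, of 8] by (intro qpoch_self_nonzero) (simp flip: power_mult)
      then have 3: "qpoch (q^4) (q^4) n \<noteq> 0" "qpoch (-(q^4)) (q^4) n \<noteq> 0"
        unfolding 2 by auto
      have 4: "a powi (2*r) = (a^2) powi r" "q powi (4*r*r) = (q^4) powi (r*r)"
        by (simp_all add: power_int_power mult.assoc)
      have 5: "qrec ((q^4)^2) r = 1 / qpoch ((q^4)^2) ((q^4)^2) n" "qrec (q^4) r = 1 / qpoch (q^4) (q^4) n" "nat r = n"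
        unfolding r qrec_of_nat by simp_all
      show ?thesis
        unfolding 4 1 5 2 using 3 by simp
    qed simp
  qed
  finally show ?thesis
    unfolding c_def[symmetric]
    by (subst has_sum_reduce_ij[OF q _ cs, where y = a and z = q and v = 1]) (simp_all add: c_def flip: power_mult)
qed

lemma quad_identity_2:
  assumes q: "nome q"
  shows "(quad_term q (\<lambda>i j k l. (-1) powi l * q powi (j + k)) has_sum
    ((qpoch_inf (q^3) (q^3))^2 / (qpoch_inf q q * qpoch_inf (q^6) (q^6)))) UNIV"
proof -
  note q0 = nome_nonzero[OF q]
  define c where "c i j k l = (-1) powi l * q powi (j + k)" for i j k l :: int
  define F where "F = (\<lambda>(i, j, m). q powi (j + m) * q powi ((i + j + m)^2 + m^2 - m) * (qrec (q^2) i * qrec (q^2) j * qrec (q^2) m))"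
  define G where "G = (\<lambda>(n, m). q powi ((n + m)^2 + m^2) * qrec q n * qrec (q^2) m)"
  define H where "H = (\<lambda>(n, m, r). (-1) powi r * q powi ((n + m)^2 + m^2 + r^2) * qrec q n * (qrec q (m - r) * qrec q (m + r)))"
  define J where "J = (\<lambda>(r, N). (-1) powi r * q powi (N^2 + 2 * r^2) * (qrec q (N - r) * qrec q (N + r)))"
  have cs: "quad_term q c summable_on UNIV"
    by (rule summable_quad_term[OF q, of _ 1 q q "-1"]) (use q0 in \<open>simp add: c_def power_int_add\<close>)
  have F: "(quad_term q c has_sum S) UNIV \<longleftrightarrow> (F has_sum S) UNIV" for S
    unfolding F_def
  proof (rule has_sum_reduce_kl[OF q _ cs])
    show "c i j k l = q powi (j + (k + 2*l)) * ((-1) powi l * q powi (- 2*l))" for i j k l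
    proof -
      have "q powi (j + k) = q powi (j + (k + 2*l)) * q powi (- 2*l)"
        unfolding powi_add[OF q0] by (rule powi_cong) simp
      then show ?thesis
        by (simp add: c_def mult_ac)
    qed
  qed
  have Fs: "F summable_on UNIV"
    using cs F unfolding summable_on_def by blast
  have FG: "(F has_sum S) UNIV \<longleftrightarrow> (G has_sum S) UNIV" for S
  proof (rule has_sum_fibers[where h = "\<lambda>((n, m), j). (n - j, j, m)" and h' = "\<lambda>(i, j, m). ((i + j, m), j)"])
    fix t :: "int \<times> int"
    obtain n m where t: "t = (n, m)"
      by (cases t) auto
    have "F (n - j, j, m) = q powi ((n + m)^2 + m^2) * qrec (q^2) m * (q powi j * qrec (q^2) j * qrec (q^2) (n - j))" for j
    proof -
      have "q powi (j + m) * q powi ((n - j + j + m)^2 + m^2 - m) = q powi ((n + m)^2 + m^2) * q powi j"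
        unfolding powi_add[OF q0] by (rule powi_cong) simp
      then show ?thesis
        unfolding F_def prod.case by algebra
    qed
    then show "((\<lambda>j. F ((\<lambda>((n, m), j). (n - j, j, m)) (t, j))) has_sum G t) UNIV"
      using has_sum_cmult_right[OF has_sum_qrec_merge[OF q, of n], of "q powi ((n + m)^2 + m^2) * qrec (q^2) m"]
      by (simp add: t G_def mult_ac)
  qed (use Fs in auto)
  \<comment> \<open>Expanding 1/(q^2;q^2)_m by Gauss' identity adds the index r, so summability of
    \<open>G\<close> does not suffice. On the support n and m are nonnegative, and the term is
    dominated by a product of three theta series in |q|, summable by the triple product at z =
    1.\<close>
  have Hs: "H summable_on UNIV"
  proof -
    obtain K where K: "K > 0" "\<And>n. norm (qrec q n) \<le> K"
      using qrec_bounded[OF q] by auto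
    define p where "p = complex_of_real (norm q)"
    have p: "nome p" and np: "norm p = norm q"
      using q by (simp_all add: nome_def p_def)
    define g where "g n = p powi (n * n)" for n :: int
    have 1: "g summable_on UNIV"
      using has_sum_imp_summable[OF Jacobi_triple_product[OF p, of 1]] by (simp add: g_def[abs_def])
    define g3 where "g3 = (\<lambda>(n, m, r). g n * (g m * g r))"
    have "g3 summable_on UNIV"
      using summable_on_times[OF 1 summable_on_times[OF 1 1]] by (simp add: g3_def case_prod_unfold)
    then have "(\<lambda>t. norm (g3 t)) summable_on UNIV"
      by (simp add: summable_on_iff_abs_summable_on_complex)
    then have "(\<lambda>t. K * K * K * norm (g3 t)) summable_on UNIV"
      by (rule summable_on_cmult_right)
    then have "(\<lambda>t. norm (H t)) summable_on UNIV"
    proof (rule summable_on_comparison_test)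
      fix t :: "int \<times> int \<times> int"
      obtain n m r where t: "t = (n, m, r)"
        by (cases t) auto
      show "norm (H t) \<le> K * K * K * norm (g3 t)"
      proof (cases "H t = 0")
        case False
        then have "qrec q n \<noteq> 0" "qrec q (m - r) \<noteq> 0" "qrec q (m + r) \<noteq> 0"
          by (auto simp: t H_def)
        then have "n \<ge> 0" "m - r \<ge> 0" "m + r \<ge> 0"
          using qrec_nonzero_imp by blast+
        then have "n \<ge> 0" "m \<ge> 0"
          by auto
        then have "n * n + m * m + r * r \<le> (n + m)^2 + m^2 + r^2"
          by (simp add: power2_eq_square algebra_simps)
        then have "norm q powi ((n + m)^2 + m^2 + r^2) \<le> norm q powi (n * n + m * m + r * r)"
          using q by (intro power_int_decreasing) (auto simp: nome_def)
        also have "\<dots> = norm (g3 t)"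
          using q0 by (simp add: g3_def g_def t norm_mult norm_power_int np power_int_add mult.assoc)
        finally have "norm (q powi ((n + m)^2 + m^2 + r^2)) \<le> norm (g3 t)"
          by (simp add: norm_power_int)
        then have "norm (H t) \<le> 1 * norm (g3 t) * K * (K * K)"
          unfolding H_def t prod.case norm_mult
          by (intro mult_mono K) (use K(1) in \<open>auto simp: norm_power_int\<close>)
        then show ?thesis
          by (simp add: mult_ac)
      qed (use K(1) in simp)
    qed auto
    then show ?thesis
      by (rule abs_summable_summable)
  qed
  have HG: "(H has_sum S) UNIV \<longleftrightarrow> (G has_sum S) UNIV" for S
  proof (rule has_sum_fibers[where h = "\<lambda>((n, m), r). (n, m, r)" and h' = "\<lambda>(n, m, r). ((n, m), r)"])
    fix t :: "int \<times> int"
    obtain n m where t: "t = (n, m)"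
      by (cases t) auto
    have "H (n, m, r) = q powi ((n + m)^2 + m^2) * qrec q n * ((-1) powi r * q powi (r*r) * qrec q (m - r) * qrec q (m + r))" for r
    proof -
      have "q powi ((n + m)^2 + m^2 + r^2) = q powi ((n + m)^2 + m^2) * q powi (r*r)"
        unfolding powi_add[OF q0] by (rule powi_cong) (simp add: power2_eq_square)
      then show ?thesis
        unfolding H_def prod.case by algebra
    qed
    then show "((\<lambda>r. H ((\<lambda>((n, m), r). (n, m, r)) (t, r))) has_sum G t) UNIV"
      using has_sum_cmult_right[OF has_sum_Gauss_finite[OF q, of m], of "q powi ((n + m)^2 + m^2) * qrec q n"]
      by (simp add: t G_def mult_ac)
  qed (use Hs in auto)
  \<comment> \<open>The Bailey step: with N = n + m the exponent is N^2 + 2r^2 + (N-r-n)(N+r-n), so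
    the sum over n is q-Vandermonde.\<close>
  have HJ: "(H has_sum S) UNIV \<longleftrightarrow> (J has_sum S) UNIV" for S
  proof (rule has_sum_fibers[where h = "\<lambda>((r, N), n). (n, N - n, r)" and h' = "\<lambda>(n, m, r). ((r, n + m), n)"])
    fix t :: "int \<times> int"
    obtain r N where t: "t = (r, N)"
      by (cases t) auto
    have "H (n, N - n, r) = (-1) powi r * q powi (N^2 + 2 * r^2) *
        (q powi ((N - r - n) * (N + r - n)) * qrec q (N - r - n) * qrec q (N + r - n) * qrec q n)" for n
    proof -
      have "q powi ((n + (N - n))^2 + (N - n)^2 + r^2) = q powi (N^2 + 2 * r^2) * q powi ((N - r - n) * (N + r - n))"
        unfolding powi_add[OF q0] by (rule powi_cong) (simp add: power2_eq_square algebra_simps)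
      moreover have "N - n - r = N - r - n" "N - n + r = N + r - n"
        by simp_all
      ultimately show ?thesis
        unfolding H_def prod.case by (simp only: mult_ac)
    qed
    then show "((\<lambda>n. H ((\<lambda>((r, N), n). (n, N - n, r)) (t, n))) has_sum J t) UNIV"
      using has_sum_cmult_right[OF has_sum_q_Vandermonde[OF q, of "N - r" "N + r"], of "(-1) powi r * q powi (N^2 + 2 * r^2)"]
      by (simp add: t J_def)
  qed (use Hs in auto)
  have Js: "J summable_on UNIV"
    using Hs HJ unfolding summable_on_def by blast
  \<comment> \<open>With s = N - r, N^2 + 2r^2 = 3r^2 + s(s + 2r): the sum over N is a Durfee
    series, and a theta series in q^3 remains.\<close>
  have JT: "(J has_sum S) UNIV \<longleftrightarrow> ((\<lambda>r. (-1) powi r * (q^3) powi (r*r) * (1 / qpoch_inf q q)) has_sum S) UNIV" for S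
  proof (rule has_sum_fibers[where h = "\<lambda>(r, N). (r, N)" and h' = "\<lambda>(r, N). (r, N)"])
    fix r :: int
    define D where "D s = q powi (s * (s + 2*r)) * qrec q s * qrec q (s + 2*r)" for s
    have "(D has_sum (1 / qpoch_inf q q)) UNIV"
      unfolding D_def by (rule has_sum_Durfee[OF q])
    then have "((\<lambda>N. D (N - r)) has_sum (1 / qpoch_inf q q)) UNIV"
      using has_sum_shift_int[of D "- r"] by simp
    then have "((\<lambda>N. (-1) powi r * (q^3) powi (r*r) * D (N - r)) has_sum ((-1) powi r * (q^3) powi (r*r) * (1 / qpoch_inf q q))) UNIV"
      by (rule has_sum_cmult_right)
    moreover have "J (r, N) = (-1) powi r * (q^3) powi (r*r) * D (N - r)" for N
    proof -
      have "q powi (N^2 + 2 * r^2) = (q^3) powi (r*r) * q powi ((N - r) * (N - r + 2*r))"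
        unfolding power_int_power powi_add[OF q0] by (rule powi_cong) (simp add: power2_eq_square algebra_simps)
      moreover have "N - r + 2 * r = N + r"
        by simp
      ultimately show ?thesis
        unfolding J_def D_def prod.case by (simp only: mult_ac)
    qed
    ultimately show "((\<lambda>N. J ((\<lambda>(r, N). (r, N)) (r, N))) has_sum ((-1) powi r * (q^3) powi (r*r) * (1 / qpoch_inf q q))) UNIV"
      by simp
  qed (use Js in auto)
  have q3: "nome (q^3)"
    by (rule nome_power[OF q]) simp
  have "((\<lambda>r. (-1) powi r * (q^3) powi (r*r) * (1 / qpoch_inf q q)) has_sum
    (qpoch_inf (-(-1) * q^3) ((q^3)^2) * qpoch_inf (-(q^3) / (-1)) ((q^3)^2) * qpoch_inf ((q^3)^2) ((q^3)^2) * (1 / qpoch_inf q q))) UNIV"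
    by (intro has_sum_cmult_left Jacobi_triple_product q3) simp
  also have "qpoch_inf (-(-1) * q^3) ((q^3)^2) * qpoch_inf (-(q^3) / (-1)) ((q^3)^2) * qpoch_inf ((q^3)^2) ((q^3)^2) * (1 / qpoch_inf q q)
      = (qpoch_inf (q^3) (q^3))^2 / (qpoch_inf q q * qpoch_inf (q^6) (q^6))"
  proof -
    have "qpoch_inf (q^3) (q^3) = qpoch_inf (q^3) (q^6) * qpoch_inf (q^6) (q^6)"
      using qpoch_inf_parity[OF nome_norm[OF q3], of "q^3"] by (simp flip: power_mult power_add)
    moreover have "qpoch_inf (q^6) (q^6) \<noteq> 0" "qpoch_inf q q \<noteq> 0"
      using nome_power[OF q, of 6] q by (simp_all add: qpoch_inf_self_nonzero)
    moreover have "(q^3)^2 = q^6"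
      by (simp flip: power_mult)
    ultimately show ?thesis
      by (simp add: power2_eq_square)
  qed
  finally have "(quad_term q c has_sum ((qpoch_inf (q^3) (q^3))^2 / (qpoch_inf q q * qpoch_inf (q^6) (q^6)))) UNIV"
    using F FG HG HJ JT by simp
  then show ?thesis
    unfolding c_def .
qed

text \<open>The weights of (5) and, next, of (4) are named because (6) and (7) are built from both.
  Their powers are grouped by the parameters y, z, v of \<open>has_sum_reduce_ij\<close>.\<close>

definition slater_even_coeff :: "complex \<Rightarrow> int \<Rightarrow> int \<Rightarrow> int \<Rightarrow> int \<Rightarrow> complex" where
  "slater_even_coeff q i j k l = (-1) powi i * q powi k * (q^2) powi l"

definition slater_odd_coeff :: "complex \<Rightarrow> int \<Rightarrow> int \<Rightarrow> int \<Rightarrow> int \<Rightarrow> complex" where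
  "slater_odd_coeff q i j k l = (-1) powi i * (q^2) powi (i + j + 2*l) * (q^3) powi k * (q^2) powi l"

lemma quad_identity_5:
  assumes q: "nome q"
  shows "(quad_term q (slater_even_coeff q) has_sum (theta16_6 q / qpoch_inf (q^2) (q^2))) UNIV"
proof -
  have cs: "quad_term q (slater_even_coeff q) summable_on UNIV"
    by (rule summable_quad_term[OF q, of _ "-1" 1 q "q^2"]) (simp add: slater_even_coeff_def)
  have "((\<lambda>r. q powi (4*r*r) * qpoch (-(q^4)) (q^4) (nat r) * qrec (q^4) r * qpoch_inf (-(q^2 * q powi (4*r))) (q^2))
      has_sum (qpoch_inf (-(q^2)) (q^2) * (theta16_6 q / qpoch_inf (q^4) (q^4)))) UNIV"
    unfolding Slater_even_term[OF q] by (intro has_sum_cmult_right has_sum_Slater q)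
  also have "qpoch_inf (-(q^2)) (q^2) * (theta16_6 q / qpoch_inf (q^4) (q^4)) = theta16_6 q / qpoch_inf (q^2) (q^2)"
    using qpoch_inf_neg_square_nonzero[OF q] by (simp add: qpoch_inf_square_4[OF q])
  finally show ?thesis
    by (subst has_sum_reduce_ij[OF q _ cs, where y = 1 and z = q and v = "q^2"])
       (simp_all add: slater_even_coeff_def mult_ac flip: power_add power2_eq_square)
qed

lemma quad_identity_4:
  assumes q: "nome q"
  shows "(quad_term q (slater_odd_coeff q) has_sum (theta16_2 q / qpoch_inf (q^2) (q^2))) UNIV"
proof -
  note q0 = nome_nonzero[OF q]
  have cs: "quad_term q (slater_odd_coeff q) summable_on UNIV"
  proof (rule summable_quad_term[OF q, of _ "-(q^2)" "q^2" "q^3" "q^6"])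
    fix i j k l
    have "(q^2) powi (int i + int j + 2 * int l) = (q^2)^(i + j + 2*l)"
      using power_int_of_nat[of "q^2" "i + j + 2*l"] by simp
    moreover have "(q^6)^l = (q^2)^(2*l) * (q^2)^l"
      by (simp flip: power_mult power_add)
    ultimately show "slater_odd_coeff q (int i) (int j) (int k) (int l) = (-(q^2)) ^ i * (q^2) ^ j * (q^3) ^ k * (q^6) ^ l"
      unfolding slater_odd_coeff_def power_minus[of "q^2"] by (simp add: power_add)
  qed
  \<comment> \<open>The factor iq makes the terms match the odd Slater series and is divided out
    afterwards.\<close>
  have "((\<lambda>r. (\<i> * q) * (q powi (4*r*r + 4*r) * qpoch (-(q^4)) (q^4) (nat r) * qrec (q^4) r * qpoch_inf (-(q^4 * q powi (4*r))) (q^2)))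
      has_sum (qpoch_inf (-(q^2)) (q^2) * ((\<i> * q) * theta16_2 q / qpoch_inf (q^4) (q^4)))) UNIV"
    unfolding Slater_odd_term[OF q] by (intro has_sum_cmult_right has_sum_Slater q)
  then have "((\<lambda>r. q powi (4*r*r + 4*r) * qpoch (-(q^4)) (q^4) (nat r) * qrec (q^4) r * qpoch_inf (-(q^4 * q powi (4*r))) (q^2))
      has_sum (qpoch_inf (-(q^2)) (q^2) * ((\<i> * q) * theta16_2 q / qpoch_inf (q^4) (q^4)) / (\<i> * q))) UNIV"
    using q0 by (subst (asm) has_sum_cmult_right_iff) auto
  also have "qpoch_inf (-(q^2)) (q^2) * ((\<i> * q) * theta16_2 q / qpoch_inf (q^4) (q^4)) / (\<i> * q) = theta16_2 q / qpoch_inf (q^2) (q^2)"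
    using qpoch_inf_neg_square_nonzero[OF q] q0 by (simp add: qpoch_inf_square_4[OF q])
  also have "(\<lambda>r. q powi (4*r*r + 4*r) * qpoch (-(q^4)) (q^4) (nat r) * qrec (q^4) r * qpoch_inf (-(q^4 * q powi (4*r))) (q^2)) =
    (\<lambda>r. (q^2) powi (2*r) * q powi (4*r*r) * qpoch (- (q^2) * q^2) (q^4) (nat r) * qrec (q^4) r * qpoch_inf (-(q^3) * q * q powi (4*r)) (q^2))"
  proof
    fix r
    have "(q^2) powi (2*r) * q powi (4*r*r) = q powi (4*r*r + 4*r)"
      using q0 by (simp add: power_int_power powi_add add.commute)
    moreover have "- (q^2) * q^2 = - (q^4)" "-(q^3) * q * q powi (4*r) = -(q^4 * q powi (4*r))"
      by (simp_all add: eval_nat_numeral)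
    ultimately show "q powi (4*r*r + 4*r) * qpoch (-(q^4)) (q^4) (nat r) * qrec (q^4) r * qpoch_inf (-(q^4 * q powi (4*r))) (q^2) =
      (q^2) powi (2*r) * q powi (4*r*r) * qpoch (- (q^2) * q^2) (q^4) (nat r) * qrec (q^4) r * qpoch_inf (-(q^3) * q * q powi (4*r)) (q^2)"
      by (simp only:)
  qed
  finally show ?thesis
    by (subst has_sum_reduce_ij[OF q _ cs, where y = "q^2" and z = "q^3" and v = "q^2"]) (simp_all add: slater_odd_coeff_def)
qed

text \<open>This is (8) with j and k exchanged. At z = 1/q, v = 1/q^2 the reduced term is twice that
  of (5): (-1;q^4)_r (1 + q^(4r)) = 2 (-q^4;q^4)_r, where 1 + q^(4r) is the first factor of the
  tail.\<close>

lemma quad_identity_8: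
  assumes q: "nome q"
  shows "(quad_term q (\<lambda>i j k l. (-1) powi i * (1/q) powi k * (1/q^2) powi l) has_sum
    (2 * theta16_6 q / qpoch_inf (q^2) (q^2))) UNIV"
proof -
  note q0 = nome_nonzero[OF q]
  define c where "c i j k l = (-1) powi i * (1/q) powi k * (1/q^2) powi l" for i j k l :: int
  have cs: "quad_term q c summable_on UNIV"
    by (rule summable_quad_term[OF q, of _ "-1" 1 "1/q" "1/q^2"]) (simp add: c_def)
  have "((\<lambda>r. 2 * (q powi (4*r*r) * qpoch (-(q^4)) (q^4) (nat r) * qrec (q^4) r * qpoch_inf (-(q^2 * q powi (4*r))) (q^2)))
      has_sum (2 * (qpoch_inf (-(q^2)) (q^2) * (theta16_6 q / qpoch_inf (q^4) (q^4))))) UNIV"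
    unfolding Slater_even_term[OF q] by (intro has_sum_cmult_right has_sum_Slater q)
  also have "2 * (qpoch_inf (-(q^2)) (q^2) * (theta16_6 q / qpoch_inf (q^4) (q^4))) = 2 * theta16_6 q / qpoch_inf (q^2) (q^2)"
    using qpoch_inf_neg_square_nonzero[OF q] by (simp add: qpoch_inf_square_4[OF q])
  also have "(\<lambda>r. 2 * (q powi (4*r*r) * qpoch (-(q^4)) (q^4) (nat r) * qrec (q^4) r * qpoch_inf (-(q^2 * q powi (4*r))) (q^2))) =
    (\<lambda>r. q powi (4*r*r) * qpoch (-1) (q^4) (nat r) * qrec (q^4) r * qpoch_inf (-(q powi (4*r))) (q^2))"
  proof
    fix r
    show "2 * (q powi (4*r*r) * qpoch (-(q^4)) (q^4) (nat r) * qrec (q^4) r * qpoch_inf (-(q^2 * q powi (4*r))) (q^2)) =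
      q powi (4*r*r) * qpoch (-1) (q^4) (nat r) * qrec (q^4) r * qpoch_inf (-(q powi (4*r))) (q^2)"
    proof (cases "r < 0")
      case False
      define n where "n = nat r"
      have r: "r = int n"
        using False by (simp add: n_def)
      have "qpoch_inf (-(q powi (4*r))) (q^2) = (1 + q powi (4*r)) * qpoch_inf (-(q^2 * q powi (4*r))) (q^2)"
        using qpoch_inf_shift[OF nome_norm[OF nome_power[OF q, of 2]], of "-(q powi (4*r))" 1]
        by (simp add: qpoch_def mult_ac)
      moreover have "2 * qpoch (-(q^4)) (q^4) n = qpoch (-1) (q^4) n * (1 + q powi (4*r))"
      proof -
        have "qpoch (-1) (q^4) (1 + n) = 2 * qpoch (-(q^4)) (q^4) n"
          by (subst qpoch_add) (simp add: qpoch_def)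
        moreover have "(q^4)^n = q powi (4*r)"
          using power_int_of_nat[of q "4*n"] by (simp add: r power_mult)
        ultimately show ?thesis
          by (simp add: qpoch_Suc)
      qed
      ultimately show ?thesis
        unfolding n_def[symmetric] by algebra
    qed simp
  qed
  finally have "(quad_term q c has_sum (2 * theta16_6 q / qpoch_inf (q^2) (q^2))) UNIV"
    by (subst has_sum_reduce_ij[OF q _ cs, where y = 1 and z = "1/q" and v = "1/q^2"]) (use q0 in \<open>simp_all add: c_def\<close>)
  then show ?thesis
    unfolding c_def .
qed

text \<open>From $q^{2i}/(q^2;q^2)_i = 1/(q^2;q^2)_i - 1/(q^2;q^2)_{i-1}$.\<close>

lemma has_sum_quad_shift:
  assumes q: "nome q"
    and c: "(quad_term q c has_sum S) UNIV" and d: "(quad_term q d has_sum T) UNIV"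
    and cd: "\<And>i j k l. d i j k l = c (i + 1) j k l * q powi (2*(i + j + k + 2*l) + 1)"
  shows "(quad_term q (\<lambda>i j k l. q powi (2*i) * c i j k l) has_sum (S - T)) UNIV"
proof -
  note q0 = nome_nonzero[OF q]
  define h where "h = (\<lambda>(i, j, k, l). (i - 1, j, k, l) :: int \<times> int \<times> int \<times> int)"
  have "((\<lambda>t. quad_term q d (h t)) has_sum T) UNIV"
    using d by (subst has_sum_reindex_bij_betw[of h UNIV UNIV])
      (auto simp: h_def intro!: o_bij[of "\<lambda>(i, j, k, l). (i + 1, j, k, l)"])
  from has_sum_add[OF c has_sum_uminusI[OF this]]
  have "((\<lambda>t. quad_term q c t + - quad_term q d (h t)) has_sum (S - T)) UNIV"
    by simp
  moreover have "quad_term q c (i, j, k, l) + - quad_term q d (i - 1, j, k, l) =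
      quad_term q (\<lambda>i j k l. q powi (2*i) * c i j k l) (i, j, k, l)" for i j k l
  proof -
    \<comment> \<open>With n = i + j + k + 2l this is (n-1)^2 + 2(n-1) + 1 = n^2, which explains the
      multiplier in the hypothesis \<open>cd\<close>.\<close>
    have "q powi (2*(i - 1 + j + k + 2*l) + 1) * q powi ((i - 1 + j + k + 2*l)^2 + 2 * l^2) =
        q powi ((i + j + k + 2*l)^2 + 2 * l^2)"
      using q0 by (simp add: powi_add power2_eq_square algebra_simps)
    then have "quad_term q d (i - 1, j, k, l) = c i j k l * q powi ((i + j + k + 2*l)^2 + 2 * l^2) *
        (((1 - q powi (2*i)) * qrec (q^2) i) * qrec (q^2) j * qrec (q^2) k * qrec (q^4) l)"
      unfolding quad_term_def cd qrec_sq_pred[OF q, symmetric] by simp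
    then show ?thesis
      unfolding quad_term_def by (simp add: algebra_simps)
  qed
  then have "(\<lambda>t. quad_term q c t + - quad_term q d (h t)) = quad_term q (\<lambda>i j k l. q powi (2*i) * c i j k l)"
    by (auto simp: fun_eq_iff h_def)
  ultimately show ?thesis
    by simp
qed

text \<open>The shifted index i carries the sign (-1)^i, so shifting the weight of (5) gives -q
  times that of (4), and the difference becomes a sum.\<close>

lemma quad_identity_7:
  assumes q: "nome q"
  shows "(quad_term q (\<lambda>i j k l. q powi (2*i) * slater_even_coeff q i j k l) has_sum
    ((theta16_6 q + q * theta16_2 q) / qpoch_inf (q^2) (q^2))) UNIV"
proof -
  note q0 = nome_nonzero[OF q]
  have "(quad_term q (\<lambda>i j k l. q powi (2*i) * slater_even_coeff q i j k l) has_sum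
    (theta16_6 q / qpoch_inf (q^2) (q^2) - (- q) * (theta16_2 q / qpoch_inf (q^2) (q^2)))) UNIV"
  proof (rule has_sum_quad_shift[OF q quad_identity_5[OF q]])
    show "(quad_term q (\<lambda>i j k l. (- q) * slater_odd_coeff q i j k l) has_sum (- q) * (theta16_2 q / qpoch_inf (q^2) (q^2))) UNIV"
      unfolding quad_term_cmult by (rule has_sum_cmult_right[OF quad_identity_4[OF q]])
    fix i j k l
    have "q powi k * q powi (2*(i + j + k + 2*l) + 1) = q powi 1 * ((q^2) powi (i + j + 2*l) * (q^3) powi k)"
      unfolding power_int_power powi_add[OF q0] by (rule powi_cong) simp
    moreover have "(-1::complex) powi (i + 1) = - ((-1) powi i)"
      by (simp add: power_int_add)
    ultimately show "(- q) * slater_odd_coeff q i j k l = slater_even_coeff q (i + 1) j k l * q powi (2*(i + j + k + 2*l) + 1)"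
      unfolding slater_odd_coeff_def slater_even_coeff_def power_int_1_right by algebra
  qed
  then show ?thesis
    by (simp add: add_divide_distrib)
qed

text \<open>As for (7), but the indices are first permuted so that the shifted one carries no sign.
  The shifted weight is then +q times that of (4), and a difference results.\<close>

lemma quad_identity_6:
  assumes q: "nome q"
  shows "(quad_term q (\<lambda>i j k l. (-1) powi i * q powi j * q powi (2*k) * (q^2) powi l) has_sum
    ((theta16_6 q - q * theta16_2 q) / qpoch_inf (q^2) (q^2))) UNIV"
proof -
  note q0 = nome_nonzero[OF q]
  have perm: "(quad_term q (\<lambda>i j k l. c k i j l) has_sum S) UNIV" if "(quad_term q c has_sum S) UNIV" for c S
  proof -
    have "(quad_term q (\<lambda>i j k l. c j i k l) has_sum S) UNIV"
      using that by (rule has_sum_quad_swap_ij[THEN iffD2])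
    then show ?thesis
      by (rule has_sum_quad_swap_jk[of q "\<lambda>i j k l. c j i k l", THEN iffD2])
  qed
  have "(quad_term q (\<lambda>i j k l. q powi (2*i) * slater_even_coeff q k i j l) has_sum
    (theta16_6 q / qpoch_inf (q^2) (q^2) - q * (theta16_2 q / qpoch_inf (q^2) (q^2)))) UNIV"
  proof (rule has_sum_quad_shift[OF q perm[OF quad_identity_5[OF q]]])
    show "(quad_term q (\<lambda>i j k l. q * slater_odd_coeff q k i j l) has_sum q * (theta16_2 q / qpoch_inf (q^2) (q^2))) UNIV"
      unfolding quad_term_cmult by (rule has_sum_cmult_right[OF perm[OF quad_identity_4[OF q]]])
    fix i j k l
    have "q powi j * q powi (2*(i + j + k + 2*l) + 1) = q powi 1 * ((q^2) powi (k + i + 2*l) * (q^3) powi j)"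
      unfolding power_int_power powi_add[OF q0] by (rule powi_cong) simp
    then show "q * slater_odd_coeff q k i j l = slater_even_coeff q k (i + 1) j l * q powi (2*(i + j + k + 2*l) + 1)"
      unfolding slater_odd_coeff_def slater_even_coeff_def power_int_1_right by algebra
  qed
  from perm[OF this]
  have "(quad_term q (\<lambda>i j k l. (-1) powi j * q powi i * q powi (2*k) * (q^2) powi l) has_sum
    ((theta16_6 q - q * theta16_2 q) / qpoch_inf (q^2) (q^2))) UNIV"
    by (simp add: slater_even_coeff_def diff_divide_distrib mult_ac)
  then show ?thesis
    by (rule has_sum_quad_swap_ij[of q "\<lambda>i j k l. (-1) powi i * q powi j * q powi (2*k) * (q^2) powi l", THEN iffD1])
qed

text \<open>In contrast to (1), a factor q^(2m) is left over in the sum over m. Writing it as 1 - (1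
  - q^(2m)) gives q-Vandermonde at (M, N) minus the same at (M - 1, N - 1). The Euler products are
  2B and B with B = (-q^2;q^2)_inf, so the 3 is 2 * 2 - 1 * 1.\<close>

lemma quad_identity_3:
  assumes q: "nome q"
  shows "(quad_term q (\<lambda>i j k l. (-1) powi l * q powi (- i - j + k)) has_sum
    (3 / qpochs_inf [q^2, q^2] (q^4))) UNIV"
proof -
  note q0 = nome_nonzero[OF q]
  define c where "c i j k l = (-1) powi l * q powi (- i - j + k)" for i j k l :: int
  define F where "F = (\<lambda>(i, j, m). q powi (- i - j + m) * q powi ((i + j + m)^2 + m^2 - m) * (qrec (q^2) i * qrec (q^2) j * qrec (q^2) m))"
  define G where "G = (\<lambda>(M::int, N::int). q powi (M*M - M) * q powi (N*N - N) *
     (qrec (q^2) M * qrec (q^2) N - qrec (q^2) (M - 1) * qrec (q^2) (N - 1)))"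
  have cs: "quad_term q c summable_on UNIV"
  proof (rule summable_quad_term[OF q])
    show "c (int i) (int j) (int k) (int l) = (1/q) ^ i * (1/q) ^ j * q ^ k * (-1) ^ l" for i j k l
    proof -
      have "q powi (- int i - int j + int k) = inverse (q ^ i) * inverse (q ^ j) * q ^ k"
        using q0 by (simp add: power_int_add power_int_diff power_int_minus divide_inverse)
      then show ?thesis
        by (simp add: c_def divide_inverse power_inverse mult_ac)
    qed
  qed
  have F: "(quad_term q c has_sum S) UNIV \<longleftrightarrow> (F has_sum S) UNIV" for S
    unfolding F_def
  proof (rule has_sum_reduce_kl[OF q _ cs])
    show "c i j k l = q powi (- i - j + (k + 2*l)) * ((-1) powi l * q powi (- 2*l))" for i j k l
    proof -
      have "q powi (- i - j + k) = q powi (- i - j + (k + 2*l)) * q powi (- 2*l)"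
        unfolding powi_add[OF q0] by (rule powi_cong) simp
      then show ?thesis
        by (simp add: c_def mult_ac)
    qed
  qed
  have Fs: "F summable_on UNIV"
    using cs F unfolding summable_on_def by blast
  have FG: "(F has_sum S) UNIV \<longleftrightarrow> (G has_sum S) UNIV" for S
  proof (rule has_sum_fibers[where h = "\<lambda>((M, N), m). (M - m, N - m, m)" and h' = "\<lambda>(i, j, m). ((i + m, j + m), m)"])
    fix t :: "int \<times> int"
    obtain M N where t: "t = (M, N)"
      by (cases t) auto
    define V where "V M N m = (q^2) powi ((M - m) * (N - m)) * qrec (q^2) (M - m) * qrec (q^2) (N - m) * qrec (q^2) m" for M N m
    have V: "(V M N has_sum qrec (q^2) M * qrec (q^2) N) UNIV" for M N
      unfolding V_def by (rule has_sum_q_Vandermonde[OF nome_power[OF q]]) simp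
    have V': "((\<lambda>m. V (M - 1) (N - 1) (m - 1)) has_sum qrec (q^2) (M - 1) * qrec (q^2) (N - 1)) UNIV"
      using V[of "M - 1" "N - 1"] has_sum_shift_int[of "V (M - 1) (N - 1)" "-1"] by simp
    have FV: "F (M - m, N - m, m) = q powi (M*M - M) * q powi (N*N - N) * (V M N m + - V (M - 1) (N - 1) (m - 1))" for m
    proof -
      have "q powi (- (M - m) - (N - m) + m) * q powi ((M - m + (N - m) + m)^2 + m^2 - m) =
          q powi (M*M - M) * q powi (N*N - N) * ((q^2) powi ((M - m) * (N - m)) * q powi (2*m))"
        unfolding power_int_power powi_add[OF q0] by (rule powi_cong) (simp add: power2_eq_square algebra_simps)
      moreover have "V (M - 1) (N - 1) (m - 1) = (q^2) powi ((M - m) * (N - m)) * qrec (q^2) (M - m) * qrec (q^2) (N - m) *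
          ((1 - q powi (2*m)) * qrec (q^2) m)"
        unfolding V_def qrec_sq_pred[OF q, symmetric] by simp
      ultimately show ?thesis
        unfolding F_def V_def prod.case by algebra
    qed
    have "((\<lambda>m. F (M - m, N - m, m)) has_sum q powi (M*M - M) * q powi (N*N - N) *
        (qrec (q^2) M * qrec (q^2) N + - (qrec (q^2) (M - 1) * qrec (q^2) (N - 1)))) UNIV"
      unfolding FV by (intro has_sum_cmult_right has_sum_add has_sum_uminusI V V')
    then show "((\<lambda>m. F ((\<lambda>((M, N), m). (M - m, N - m, m)) (t, m))) has_sum G t) UNIV"
      by (simp add: t G_def)
  qed (use Fs in auto)
  define B where "B = qpoch_inf (-(q^2)) (q^2)"
  have "((\<lambda>n. (1/q) powi n * q powi (n*n) * qrec (q^2) n) has_sum qpoch_inf (-(1/q)*q) (q^2)) UNIV"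
    by (rule has_sum_Euler[OF q])
  also have "(\<lambda>n. (1/q) powi n * q powi (n*n) * qrec (q^2) n) = (\<lambda>n. q powi (n*n - n) * qrec (q^2) n)"
    using q0 by (simp add: power_int_one_over power_int_diff)
  also have "qpoch_inf (-(1/q)*q) (q^2) = 2 * B"
    using qpoch_inf_shift[OF nome_norm[OF nome_power[OF q, of 2]], of "-1" 1] q0 by (simp add: B_def qpoch_def)
  finally have 1: "((\<lambda>n. q powi (n*n - n) * qrec (q^2) n) has_sum 2 * B) UNIV" .
  have "((\<lambda>n. q powi n * q powi (n*n) * qrec (q^2) n) has_sum qpoch_inf (-q*q) (q^2)) UNIV"
    by (rule has_sum_Euler[OF q])
  also have "-q*q = -(q^2)"
    by (simp add: power2_eq_square)
  also have "(\<lambda>n. q powi n * q powi (n*n) * qrec (q^2) n) = (\<lambda>n. q powi ((n+1)*(n+1) - (n+1)) * qrec (q^2) ((n+1) - 1))"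
    using q0 by (simp add: powi_add algebra_simps)
  finally have 2: "((\<lambda>n. q powi (n*n - n) * qrec (q^2) (n - 1)) has_sum B) UNIV"
    using has_sum_shift_int[of "\<lambda>n. q powi (n*n - n) * qrec (q^2) (n - 1)" 1] by (simp add: B_def)
  have "((\<lambda>t. (case t of (M, N) \<Rightarrow> (q powi (M*M - M) * qrec (q^2) M) * (q powi (N*N - N) * qrec (q^2) N)) +
     - (case t of (M, N) \<Rightarrow> (q powi (M*M - M) * qrec (q^2) (M - 1)) * (q powi (N*N - N) * qrec (q^2) (N - 1)))) has_sum
      ((2 * B) * (2 * B) + - (B * B))) UNIV"
    by (intro has_sum_add has_sum_uminusI has_sum_times 1 2)
  also have "(\<lambda>t. (case t of (M, N) \<Rightarrow> (q powi (M*M - M) * qrec (q^2) M) * (q powi (N*N - N) * qrec (q^2) N)) +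
     - (case t of (M, N) \<Rightarrow> (q powi (M*M - M) * qrec (q^2) (M - 1)) * (q powi (N*N - N) * qrec (q^2) (N - 1)))) = G"
    by (auto simp: G_def fun_eq_iff algebra_simps)
  also have "(2 * B) * (2 * B) + - (B * B) = 3 / qpochs_inf [q^2, q^2] (q^4)"
  proof -
    define A where "A = qpoch_inf (q^2) (q^4)"
    have e: "qpoch_inf (q^2) (q^2) = A * qpoch_inf (q^4) (q^4)"
      using qpoch_inf_parity[OF nome_norm[OF nome_power[OF q, of 2]], of "q^2"] by (simp add: A_def flip: power_mult power_add)
    \<comment> \<open>Cancelling (q^4;q^4)_inf leaves Euler's identity (q^2;q^4)_inf (-q^2;q^2)_inf
      = 1.\<close>
    have "qpoch_inf (q^4) (q^4) = A * qpoch_inf (q^4) (q^4) * B"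
      using qpoch_inf_square_4[OF q] unfolding e B_def .
    moreover have "qpoch_inf (q^4) (q^4) \<noteq> 0"
      by (rule qpoch_inf_self_nonzero[OF nome_power[OF q]]) simp
    moreover have "x * (A * B - 1) = 0" if "x = A * x * B" for x
      using that by algebra
    ultimately have AB: "A * B = 1"
      by (metis mult_eq_0_iff right_minus_eq)
    then have "A \<noteq> 0"
      by auto
    then have B: "B = 1 / A"
      using AB by (simp add: nonzero_eq_divide_eq mult.commute)
    show ?thesis
      unfolding B by (simp add: qpochs_inf_def A_def[symmetric])
  qed
  finally have "(quad_term q c has_sum (3 / qpochs_inf [q^2, q^2] (q^4))) UNIV"
    using F FG by simp
  then show ?thesis
    unfolding c_def .
qed

theorem theorem5p1:
  fixes q a b :: complex
  assumes "0 < norm q" and "norm q < 1"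
  shows
   "((\<lambda>(i,j,k,l). (-1)^(i+j+l) * q^(quadQ i j k l + k) * a^(i+k+2*l) * b^(j+k+2*l) / denomD q i j k l)
       has_sum qpochs_inf [a*q, b*q] (q^2)) UNIV
  \<and> ((\<lambda>(i,j,k,l). (-1)^l * q^(quadQ i j k l + j + k) / denomD q i j k l)
       has_sum ((qpoch_inf (q^3) (q^3))^2 / (qpoch_inf q q * qpoch_inf (q^6) (q^6)))) UNIV
  \<and> ((\<lambda>(i,j,k,l). (-1)^l * q powi (int (quadQ i j k l) - int i - int j + int k) / denomD q i j k l)
       has_sum (3 / qpochs_inf [q^2, q^2] (q^4))) UNIV
  \<and> ((\<lambda>(i,j,k,l). (-1)^i * q^(quadQ i j k l + 2*i + 2*j + 3*k + 6*l) / denomD q i j k l)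
       has_sum (qpochs_inf [q^2, q^14, q^16] (q^16) / qpoch_inf (q^2) (q^2))) UNIV
  \<and> ((\<lambda>(i,j,k,l). (-1)^i * q^(quadQ i j k l + k + 2*l) / denomD q i j k l)
       has_sum (qpochs_inf [q^6, q^10, q^16] (q^16) / qpoch_inf (q^2) (q^2))) UNIV
  \<and> ((\<lambda>(i,j,k,l). (-1)^i * q^(quadQ i j k l + j + 2*k + 2*l) / denomD q i j k l)
       has_sum (qpochs_inf [q, q^7, q^8, q^9, q^15] (q^16)
         / qpochs_inf [q^2, q^3, q^4, q^4, q^5, q^11, q^12, q^12, q^13, q^14] (q^16))) UNIV
  \<and> ((\<lambda>(i,j,k,l). (-1)^i * q^(quadQ i j k l + 2*i + k + 2*l) / denomD q i j k l)
       has_sum (qpochs_inf [q^3, q^5, q^8, q^11, q^13] (q^16)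
         / qpochs_inf [q, q^4, q^4, q^6, q^7, q^9, q^10, q^12, q^12, q^15] (q^16))) UNIV
  \<and> ((\<lambda>(i,j,k,l). (-1)^i * q powi (int (quadQ i j k l) - int j - 2 * int l) / denomD q i j k l)
       has_sum (2 * qpochs_inf [q^6, q^10, q^16] (q^16) / qpoch_inf (q^2) (q^2))) UNIV
  \<and> ((\<lambda>(i,j,k,l). (-1)^j * q^(quadQ i j k l + k) * a^(i+j+2*l) / denomD q i j k l)
       has_sum (qpoch_inf (-(q^2)) (q^2) * qpoch_inf (-(a^2*q^4)) (q^8))) UNIV"
proof -
  have q: "nome q" and q0: "q \<noteq> 0"
    using assms by (auto simp: nome_def)
  have *: "((\<lambda>(i, j, k, l). f i j k l / denomD q i j k l) has_sum S) UNIV"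
    if "(quad_term q c has_sum S) UNIV"
      and "\<And>i j k l. f i j k l = c (int i) (int j) (int k) (int l) * q ^ quadQ i j k l" for f c S
    using that(1) by (simp add: that(2) flip: has_sum_quad_term)
  show ?thesis
  proof (intro conjI)
    show "((\<lambda>(i,j,k,l). (-1)^(i+j+l) * q^(quadQ i j k l + k) * a^(i+k+2*l) * b^(j+k+2*l) / denomD q i j k l)
       has_sum qpochs_inf [a*q, b*q] (q^2)) UNIV"
    proof (rule *)
      show "(quad_term q (\<lambda>i j k l. (-1) powi (i + j + l) * q powi k * a powi (i + k + 2*l) * b powi (j + k + 2*l))
        has_sum qpochs_inf [a*q, b*q] (q^2)) UNIV"
        using quad_identity_1[OF q, of a b] by (simp add: qpochs_inf_def)
      show "(-1)^(i+j+l) * q^(quadQ i j k l + k) * a^(i+k+2*l) * b^(j+k+2*l) =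
        (-1) powi (int i + int j + int l) * q powi int k * a powi (int i + int k + 2 * int l) *
        b powi (int j + int k + 2 * int l) * q ^ quadQ i j k l" for i j k l
        using power_int_of_nat[of "-1::complex" "i + j + l"] power_int_of_nat[of a "i + k + 2*l"]
          power_int_of_nat[of b "j + k + 2*l"] by (simp add: power_add[of q])
    qed
    show "((\<lambda>(i,j,k,l). (-1)^l * q^(quadQ i j k l + j + k) / denomD q i j k l)
       has_sum ((qpoch_inf (q^3) (q^3))^2 / (qpoch_inf q q * qpoch_inf (q^6) (q^6)))) UNIV"
      by (rule *[OF quad_identity_2[OF q]]) (simp add: power_add power_int_add q0)
    show "((\<lambda>(i,j,k,l). (-1)^l * q powi (int (quadQ i j k l) - int i - int j + int k) / denomD q i j k l)
       has_sum (3 / qpochs_inf [q^2, q^2] (q^4))) UNIV"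
      by (rule *[OF quad_identity_3[OF q]]) (simp add: power_int_add power_int_diff power_int_minus q0 field_simps)
    show "((\<lambda>(i,j,k,l). (-1)^i * q^(quadQ i j k l + 2*i + 2*j + 3*k + 6*l) / denomD q i j k l)
       has_sum (qpochs_inf [q^2, q^14, q^16] (q^16) / qpoch_inf (q^2) (q^2))) UNIV"
    proof (rule *[OF quad_identity_4[OF q, unfolded theta16_2_def]])
      fix i j k l
      have "(q^2) powi (int i + int j + 2 * int l) = q^(2*i + 2*j + 4*l)"
        using power_int_of_nat[of "q^2" "i + j + 2*l"] by (simp add: algebra_simps flip: power_mult)
      moreover have "q^(quadQ i j k l + 2*i + 2*j + 3*k + 6*l) = q^(2*i + 2*j + 4*l) * (q^3)^k * (q^2)^l * q^quadQ i j k l"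
        by (simp add: algebra_simps flip: power_mult power_add)
      ultimately show "(-1)^i * q^(quadQ i j k l + 2*i + 2*j + 3*k + 6*l) =
          slater_odd_coeff q (int i) (int j) (int k) (int l) * q ^ quadQ i j k l"
        by (simp add: slater_odd_coeff_def)
    qed
    show "((\<lambda>(i,j,k,l). (-1)^i * q^(quadQ i j k l + k + 2*l) / denomD q i j k l)
       has_sum (qpochs_inf [q^6, q^10, q^16] (q^16) / qpoch_inf (q^2) (q^2))) UNIV"
      by (rule *[OF quad_identity_5[OF q, unfolded theta16_6_def]]) (simp add: slater_even_coeff_def power_add power_mult)
    show "((\<lambda>(i,j,k,l). (-1)^i * q^(quadQ i j k l + j + 2*k + 2*l) / denomD q i j k l)
       has_sum (qpochs_inf [q, q^7, q^8, q^9, q^15] (q^16)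
         / qpochs_inf [q^2, q^3, q^4, q^4, q^5, q^11, q^12, q^12, q^13, q^14] (q^16))) UNIV"
    proof (rule *)
      show "(quad_term q (\<lambda>i j k l. (-1) powi i * q powi j * q powi (2*k) * (q^2) powi l) has_sum
          (qpochs_inf [q, q^7, q^8, q^9, q^15] (q^16)
         / qpochs_inf [q^2, q^3, q^4, q^4, q^5, q^11, q^12, q^12, q^13, q^14] (q^16))) UNIV"
        using quad_identity_6[OF q] unfolding theta16_factors(2)[OF q] by (simp add: qpochs_inf_def mult.assoc)
    qed (simp add: power_add power_mult power_int_mult)
    show "((\<lambda>(i,j,k,l). (-1)^i * q^(quadQ i j k l + 2*i + k + 2*l) / denomD q i j k l)
       has_sum (qpochs_inf [q^3, q^5, q^8, q^11, q^13] (q^16)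
         / qpochs_inf [q, q^4, q^4, q^6, q^7, q^9, q^10, q^12, q^12, q^15] (q^16))) UNIV"
    proof (rule *)
      show "(quad_term q (\<lambda>i j k l. q powi (2*i) * slater_even_coeff q i j k l) has_sum
          (qpochs_inf [q^3, q^5, q^8, q^11, q^13] (q^16)
         / qpochs_inf [q, q^4, q^4, q^6, q^7, q^9, q^10, q^12, q^12, q^15] (q^16))) UNIV"
        using quad_identity_7[OF q] unfolding theta16_factors(1)[OF q] by (simp add: qpochs_inf_def mult.assoc)
    qed (simp add: slater_even_coeff_def power_add power_mult power_int_mult)
    show "((\<lambda>(i,j,k,l). (-1)^i * q powi (int (quadQ i j k l) - int j - 2 * int l) / denomD q i j k l)
       has_sum (2 * qpochs_inf [q^6, q^10, q^16] (q^16) / qpoch_inf (q^2) (q^2))) UNIV"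
    proof (rule *)
      show "(quad_term q (\<lambda>i j k l. (-1) powi i * (1/q) powi j * (1/q^2) powi l) has_sum
        (2 * qpochs_inf [q^6, q^10, q^16] (q^16) / qpoch_inf (q^2) (q^2))) UNIV"
        using quad_identity_8[OF q] unfolding theta16_6_def by (rule has_sum_quad_swap_jk[THEN iffD2])
      show "(-1)^i * q powi (int (quadQ i j k l) - int j - 2 * int l) =
        (-1) powi int i * (1/q) powi int j * (1/q^2) powi int l * q ^ quadQ i j k l" for i j k l
      proof -
        have "q powi (int (quadQ i j k l) - int j - 2 * int l) = q powi (int (quadQ i j k l) - int (j + 2*l))"
          by (rule powi_cong) simp
        also have "\<dots> = q ^ quadQ i j k l / q ^ (j + 2*l)"
          unfolding power_int_of_nat[symmetric] by (rule power_int_diff) (simp add: q0)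
        also have "\<dots> = (1/q) ^ j * (1/q^2) ^ l * q ^ quadQ i j k l"
          by (simp add: power_add power_mult power_one_over)
        finally show ?thesis
          by simp
      qed
    qed
    show "((\<lambda>(i,j,k,l). (-1)^j * q^(quadQ i j k l + k) * a^(i+j+2*l) / denomD q i j k l)
       has_sum (qpoch_inf (-(q^2)) (q^2) * qpoch_inf (-(a^2*q^4)) (q^8))) UNIV"
    proof (rule *)
      show "(quad_term q (\<lambda>i j k l. (-1) powi j * q powi k * a powi (j + i + 2*l)) has_sum
        (qpoch_inf (-(q^2)) (q^2) * qpoch_inf (-(a^2*q^4)) (q^8))) UNIV"
        using quad_identity_9[OF q, of a] by (rule has_sum_quad_swap_ij[THEN iffD2])
      show "(-1)^j * q^(quadQ i j k l + k) * a^(i+j+2*l) =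
        (-1) powi int j * q powi int k * a powi (int j + int i + 2 * int l) * q ^ quadQ i j k l" for i j k l
        using power_int_of_nat[of a "j + i + 2*l"] by (simp add: power_add[of q] add.commute)
    qed
  qed
qed

end
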